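(* Let $m_1,m_2\in\mathbb{R}$ and $\sigma_1,\sigma_2>0$ be fixed. For $\theta\in(-1,1)$ let $(X,Y)$ be bivariate normal with means $m_1,m_2$, variances $\sigma_1^2,\sigma_2^2$ and correlation $\theta$, and let $\kappa(\theta)=\kappa(X,Y)$ be Bergsma's covariance of $(X,Y)$. Then $\kappa(\theta)$ is a convex function of $\theta\in(-1,1)$.
   Context: For a distribution function $F$ on $\mathbb{R}$ with finite mean, with $Z_1,Z_2$ i.i.d. $F$, define $h_F(z_1,z_2)=-\tfrac12\,\mathbb{E}\big(|z_1-z_2|-|z_1-Z_2|-|Z_1-z_2|+|Z_1-Z_2|\big)$. For a bivariate random variable $(X,Y)$ with marginal distribution functions $F_1,F_2$ of finite variance, Bergsma's covariance is $\kappa(X,Y)=\mathbb{E}[h_{F_1}(X_1,X_2)\,h_{F_2}(Y_1,Y_2)]$, where $(X_1,Y_1),(X_2,Y_2)$ are i.i.d. copies of $(X,Y)$. *)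

theory Defs
  imports "HOL-Probability.Probability"
begin

text \<open>
  For a distribution function \<open>F\<close>, \<open>interval_measure F\<close> is the law with distribution function \<open>F\<close>,
  so the product measure below is the law of an independent pair \<open>(Z\<^sub>1, Z\<^sub>2)\<close> with common
  distribution function \<open>F\<close>. The integrand is integrable whenever \<open>F\<close> has finite mean; for other
  \<open>F\<close> the Bochner integral may default to 0.
\<close>

definition bergsma_kernel :: "(real \<Rightarrow> real) \<Rightarrow> real \<Rightarrow> real \<Rightarrow> real" where
  "bergsma_kernel F z1 z2 =
     - (1 / 2) * (\<integral>Z. (\<bar>z1 - z2\<bar> - \<bar>z1 - snd Z\<bar> - \<bar>fst Z - z2\<bar> + \<bar>fst Z - snd Z\<bar>)
                    \<partial>(interval_measure F \<Otimes>\<^sub>M interval_measure F))"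

text \<open>
  The two independent copies of \<open>(X, Y)\<close> live on the product space: they are
  \<open>(X (fst w), Y (fst w))\<close> and \<open>(X (snd w), Y (snd w))\<close>. The marginals are meant to have finite
  variance.
\<close>

definition bergsma_cov :: "'a measure \<Rightarrow> ('a \<Rightarrow> real) \<Rightarrow> ('a \<Rightarrow> real) \<Rightarrow> real" where
  "bergsma_cov M X Y =
     (\<integral>w. bergsma_kernel (cdf (distr M borel X)) (X (fst w)) (X (snd w)) *
          bergsma_kernel (cdf (distr M borel Y)) (Y (fst w)) (Y (snd w)) \<partial>(M \<Otimes>\<^sub>M M))"

text \<open>
  Joint density of the bivariate normal law with means \<open>m1\<close>, \<open>m2\<close>, standard deviations
  \<open>s1\<close>, \<open>s2 > 0\<close> and correlation \<open>r\<close> with \<open>\<bar>r\<bar> < 1\<close>.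
\<close>

definition bivariate_normal_density ::
  "real \<Rightarrow> real \<Rightarrow> real \<Rightarrow> real \<Rightarrow> real \<Rightarrow> real \<times> real \<Rightarrow> real" where
  "bivariate_normal_density m1 m2 s1 s2 r = (\<lambda>(x, y).
     exp (- (((x - m1) / s1)\<^sup>2 - 2 * r * ((x - m1) / s1) * ((y - m2) / s2) + ((y - m2) / s2)\<^sup>2)
            / (2 * (1 - r\<^sup>2)))
     / (2 * pi * s1 * s2 * sqrt (1 - r\<^sup>2)))"

end

theory Submission
  imports Defs "HOL-Real_Asymp.Real_Asymp"
begin

text \<open>
  For arbitrary square integrable variables, double centring of the kernels gives
  \<open>4 \<kappa>(X, Y) = E \<bar>X\<^sub>1 - X\<^sub>2\<bar> \<bar>Y\<^sub>1 - Y\<^sub>2\<bar> + E \<bar>X\<^sub>1 - X\<^sub>2\<bar> E \<bar>Y\<^sub>1 - Y\<^sub>2\<bar> - 2 E \<bar>X\<^sub>1 - X\<^sub>2\<bar> \<bar>Y\<^sub>1 - Y\<^sub>3\<bar>\<close>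
  (lemma \<open>bergsma_cov_eq_distance_moments\<close>). For a bivariate normal pair with correlation \<open>\<theta>\<close>
  all differences are again jointly normal: \<open>X\<^sub>1 - X\<^sub>2\<close> and \<open>Y\<^sub>1 - Y\<^sub>2\<close> have correlation \<open>\<theta>\<close>,
  whereas \<open>X\<^sub>1 - X\<^sub>2\<close> and \<open>Y\<^sub>1 - Y\<^sub>3\<close> share only the first copy and have correlation
  \<open>\<theta> / 2\<close>. So everything reduces to the absolute product moment of two standard normal
  variables with correlation \<open>r\<close>, which is \<open>2 / \<pi>\<close> times
  \<open>J r = r * arcsin r + sqrt (1 - r\<^sup>2)\<close> (lemma \<open>abs_product_moment_bivariate_normal\<close>).

  The result is the closed form
  \<open>\<kappa> \<theta> = \<sigma>1 * \<sigma>2 / \<pi> * (J \<theta> - 2 * J (\<theta> / 2) + 1)\<close> (lemma \<open>bergsma_cov_bivariate_normal\<close>).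
  As \<open>J\<close> has derivative \<open>arcsin\<close>, the second derivative of the bracket is
  \<open>1 / sqrt (1 - \<theta>\<^sup>2) - 1 / (2 * sqrt (1 - \<theta>\<^sup>2 / 4))\<close>, which is positive.

  To identify the joint laws of the differences, the pair is written as an affine image of two
  independent standard normal variables. What is needed about these is the rotation invariance of
  their joint law (lemma \<open>std_normal_rotation\<close>). It is proved and used for nonnegative integrals, so the many
  exchanges of integrals carry no integrability conditions.
\<close>

section \<open>Bergsma covariance in terms of mean distances\<close>

text \<open>
  This returns from the distribution function, in which the kernel is phrased, to the law itself, so
  that the kernel can be computed with the random variable instead of an abstract copy of it.
\<close>

lemma interval_measure_cdf:
  assumes "real_distribution D"
  shows "interval_measure (cdf D) = D"
proof -
  interpret D: real_distribution D by fact
  have "real_distribution (interval_measure (cdf D))"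
    by (intro real_distribution_interval_measure D.cdf_nondecreasing D.cdf_is_right_cont
        D.cdf_lim_at_bot D.cdf_lim_at_top_prob)
  moreover have "cdf (interval_measure (cdf D)) = cdf D"
    by (intro cdf_interval_measure D.cdf_nondecreasing D.cdf_is_right_cont D.cdf_lim_at_bot)
  ultimately show ?thesis
    using assms cdf_unique by blast
qed

lemma integrable_pair_fst:
  fixes f :: "'a \<Rightarrow> real"
  assumes "prob_space M" "prob_space N" "integrable M f"
  shows "integrable (M \<Otimes>\<^sub>M N) (\<lambda>w. f (fst w))"
proof -
  interpret M: prob_space M by fact
  interpret N: prob_space N by fact
  have "integrable (distr (M \<Otimes>\<^sub>M N) M fst) f"
    using assms(3) by (simp add: N.distr_pair_fst)
  then show ?thesis by (rule integrable_distr[rotated]) simp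
qed

lemma integrable_pair_snd:
  fixes f :: "'a \<Rightarrow> real"
  assumes "prob_space M" "prob_space N" "integrable N f"
  shows "integrable (M \<Otimes>\<^sub>M N) (\<lambda>w. f (snd w))"
proof -
  interpret M: prob_space M by fact
  interpret N: prob_space N by fact
  interpret P: pair_sigma_finite N M ..
  show ?thesis
    using P.integrable_product_swap[OF integrable_pair_fst[OF assms(2,1,3)]]
    by (simp add: case_prod_unfold)
qed

lemma integrable_mult_square_integrable:
  fixes f g :: "'a \<Rightarrow> real"
  assumes [measurable]: "f \<in> borel_measurable M" "g \<in> borel_measurable M"
    and "integrable M (\<lambda>x. (f x)\<^sup>2)" "integrable M (\<lambda>x. (g x)\<^sup>2)"
  shows "integrable M (\<lambda>x. f x * g x)"
proof (rule Bochner_Integration.integrable_bound)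
  show "integrable M (\<lambda>x. (f x)\<^sup>2 + (g x)\<^sup>2)" using assms by simp
  have "\<bar>u * v\<bar> \<le> u\<^sup>2 + v\<^sup>2" for u v :: real
  proof -
    have "0 \<le> (\<bar>u\<bar> - \<bar>v\<bar>)\<^sup>2" by simp
    then have "2 * (\<bar>u\<bar> * \<bar>v\<bar>) \<le> u\<^sup>2 + v\<^sup>2" by (simp add: power2_diff)
    moreover have "0 \<le> \<bar>u\<bar> * \<bar>v\<bar>" by simp
    ultimately show ?thesis unfolding abs_mult by linarith
  qed
  then show "AE x in M. norm (f x * g x) \<le> norm ((f x)\<^sup>2 + (g x)\<^sup>2)"
    by simp
qed simp

text \<open>
  For fixed \<open>z\<close> this is the one-point average of distances that the kernel subtracts in order to
  centre \<open>\<bar>z1 - z2\<bar>\<close> in each of its arguments.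
\<close>

definition mean_distance :: "'a measure \<Rightarrow> ('a \<Rightarrow> real) \<Rightarrow> real \<Rightarrow> real" where
  "mean_distance M X z = (\<integral>\<omega>. \<bar>z - X \<omega>\<bar> \<partial>M)"

lemma borel_measurable_mean_distance [measurable]:
  assumes "prob_space M" and [measurable]: "X \<in> borel_measurable M"
  shows "mean_distance M X \<in> borel_measurable borel"
proof -
  interpret prob_space M by fact
  show ?thesis unfolding mean_distance_def by measurable
qed

lemma mean_distance_bounds:
  assumes "prob_space M" "integrable M X"
  shows "0 \<le> mean_distance M X z" "mean_distance M X z \<le> \<bar>z\<bar> + (\<integral>\<omega>. \<bar>X \<omega>\<bar> \<partial>M)"
proof -
  interpret prob_space M by fact
  show "0 \<le> mean_distance M X z" by (simp add: mean_distance_def)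
  have "mean_distance M X z \<le> (\<integral>\<omega>. \<bar>z\<bar> + \<bar>X \<omega>\<bar> \<partial>M)"
    unfolding mean_distance_def using assms(2) by (intro integral_mono) auto
  then show "mean_distance M X z \<le> \<bar>z\<bar> + (\<integral>\<omega>. \<bar>X \<omega>\<bar> \<partial>M)"
    using assms(2) by (simp add: prob_space)
qed

text \<open>
  By the triangle inequality \<open>mean_distance M X z\<close> is at most \<open>\<bar>z\<bar>\<close> plus a constant, so
  it inherits square integrability from \<open>X\<close>.
\<close>

lemma integrable_mean_distance_power2:
  assumes "prob_space M" and [measurable]: "X \<in> borel_measurable M"
    and sq: "integrable M (\<lambda>\<omega>. (X \<omega>)\<^sup>2)"
  shows "integrable M (\<lambda>\<omega>. (mean_distance M X (X \<omega>))\<^sup>2)"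
proof -
  interpret prob_space M by fact
  note [measurable] = borel_measurable_mean_distance[OF assms(1,2)]
  have X: "integrable M X" using sq by (rule square_integrable_imp_integrable[rotated]) simp
  define c where "c = (\<integral>\<omega>. \<bar>X \<omega>\<bar> \<partial>M)"
  show ?thesis
  proof (rule Bochner_Integration.integrable_bound)
    show "integrable M (\<lambda>\<omega>. (X \<omega>)\<^sup>2 + 2 * c * \<bar>X \<omega>\<bar> + c\<^sup>2)" using sq X by simp
    have "(mean_distance M X z)\<^sup>2 \<le> z\<^sup>2 + 2 * c * \<bar>z\<bar> + c\<^sup>2" for z
    proof -
      have "(mean_distance M X z)\<^sup>2 \<le> (\<bar>z\<bar> + c)\<^sup>2"
        using mean_distance_bounds[OF assms(1) X] by (intro power_mono) (auto simp: c_def)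
      then show ?thesis by (simp add: power2_sum algebra_simps)
    qed
    then show "AE \<omega> in M. norm ((mean_distance M X (X \<omega>))\<^sup>2) \<le> norm ((X \<omega>)\<^sup>2 + 2 * c * \<bar>X \<omega>\<bar> + c\<^sup>2)"
      by (intro AE_I2) (smt (verit) real_norm_def zero_le_power2)
  qed simp
qed

lemma bergsma_kernel_eq_centred_distance:
  assumes "prob_space M" and X: "integrable M X"
  shows "bergsma_kernel (cdf (distr M borel X)) z1 z2 =
    - (1 / 2) * (\<bar>z1 - z2\<bar> - mean_distance M X z1 - mean_distance M X z2
                 + (\<integral>\<omega>. mean_distance M X (X \<omega>) \<partial>M))"
proof -
  interpret M: prob_space M by fact
  interpret P: pair_prob_space M M ..
  have [measurable]: "X \<in> borel_measurable M" using X by auto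
  let ?D = "distr M borel X"
  interpret D: prob_space ?D by (rule M.prob_space_distr) simp
  have D: "interval_measure (cdf ?D) = ?D"
    by (rule interval_measure_cdf) simp
  have DD: "?D \<Otimes>\<^sub>M ?D = distr (M \<Otimes>\<^sub>M M) (borel \<Otimes>\<^sub>M borel) (\<lambda>(\<omega>1, \<omega>2). (X \<omega>1, X \<omega>2))"
    by (rule pair_measure_distr) (auto intro: D.sigma_finite_measure_axioms)
  have int1: "integrable (M \<Otimes>\<^sub>M M) (\<lambda>w. X (fst w))"
    using assms(1) assms(1) X by (rule integrable_pair_fst)
  have int2: "integrable (M \<Otimes>\<^sub>M M) (\<lambda>w. X (snd w))"
    using assms(1) assms(1) X by (rule integrable_pair_snd)
  have i2: "integrable (M \<Otimes>\<^sub>M M) (\<lambda>w. \<bar>z1 - X (snd w)\<bar>)" using int2 by simp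
  have i1: "integrable (M \<Otimes>\<^sub>M M) (\<lambda>w. \<bar>X (fst w) - z2\<bar>)" using int1 by simp
  have i12: "integrable (M \<Otimes>\<^sub>M M) (\<lambda>w. \<bar>X (fst w) - X (snd w)\<bar>)" using int1 int2 by simp
  have e2: "(\<integral>w. \<bar>z1 - X (snd w)\<bar> \<partial>(M \<Otimes>\<^sub>M M)) = mean_distance M X z1"
    using P.integral_fst'[OF i2] by (simp add: mean_distance_def M.prob_space)
  have e1: "(\<integral>w. \<bar>X (fst w) - z2\<bar> \<partial>(M \<Otimes>\<^sub>M M)) = mean_distance M X z2"
    using P.integral_fst'[OF i1] by (simp add: mean_distance_def M.prob_space abs_minus_commute)
  have e12: "(\<integral>w. \<bar>X (fst w) - X (snd w)\<bar> \<partial>(M \<Otimes>\<^sub>M M)) = (\<integral>\<omega>. mean_distance M X (X \<omega>) \<partial>M)"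
    using P.integral_fst'[OF i12] by (simp add: mean_distance_def)
  show ?thesis
    unfolding bergsma_kernel_def D DD
    apply (subst integral_distr)
      apply simp
     apply simp
    using i1 i2 i12 e1 e2 e12
    apply (simp add: case_prod_unfold P.P.prob_space)
    done
qed

text \<open>
  The first kernel is doubly centred: integrating out either of its arguments gives 0. Multiplied by
  the second kernel it therefore annihilates every term of the latter that depends on one copy only,
  and just \<open>\<bar>Y\<^sub>1 - Y\<^sub>2\<bar>\<close> survives. Expanding the remaining product gives the familiar
  three-term form
  \<open>4 \<kappa> = E \<bar>X\<^sub>1 - X\<^sub>2\<bar> \<bar>Y\<^sub>1 - Y\<^sub>2\<bar> + E \<bar>X\<^sub>1 - X\<^sub>2\<bar> E \<bar>Y\<^sub>1 - Y\<^sub>2\<bar> - 2 E \<bar>X\<^sub>1 - X\<^sub>2\<bar> \<bar>Y\<^sub>1 - Y\<^sub>3\<bar>\<close>.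
  Square integrability of both variables is what makes all the products of distances integrable.
\<close>

lemma bergsma_cov_eq_distance_moments:
  assumes "prob_space M"
    and [measurable]: "X \<in> borel_measurable M" "Y \<in> borel_measurable M"
    and sqX: "integrable M (\<lambda>\<omega>. (X \<omega>)\<^sup>2)" and sqY: "integrable M (\<lambda>\<omega>. (Y \<omega>)\<^sup>2)"
  shows "bergsma_cov M X Y = 1 / 4 *
    ((\<integral>w. \<bar>X (fst w) - X (snd w)\<bar> * \<bar>Y (fst w) - Y (snd w)\<bar> \<partial>(M \<Otimes>\<^sub>M M))
     + (\<integral>\<omega>. mean_distance M X (X \<omega>) \<partial>M) * (\<integral>\<omega>. mean_distance M Y (Y \<omega>) \<partial>M)
     - 2 * (\<integral>\<omega>. mean_distance M X (X \<omega>) * mean_distance M Y (Y \<omega>) \<partial>M))"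
proof -
  interpret M: prob_space M by fact
  interpret P: pair_prob_space M M ..
  let ?MM = "M \<Otimes>\<^sub>M M"
  have X: "integrable M X" using sqX by (rule M.square_integrable_imp_integrable[rotated]) simp
  have Y: "integrable M Y" using sqY by (rule M.square_integrable_imp_integrable[rotated]) simp
  note [measurable] = borel_measurable_mean_distance[OF assms(1,2)]
    borel_measurable_mean_distance[OF assms(1,3)]
  define a where "a = (\<lambda>\<omega>. mean_distance M X (X \<omega>))"
  define b where "b = (\<lambda>\<omega>. mean_distance M Y (Y \<omega>))"
  have [measurable]: "a \<in> borel_measurable M" "b \<in> borel_measurable M"
    unfolding a_def b_def by measurable
  define \<alpha> where "\<alpha> = (\<integral>\<omega>. a \<omega> \<partial>M)"
  define \<beta> where "\<beta> = (\<integral>\<omega>. b \<omega> \<partial>M)"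
  define dX where "dX w = \<bar>X (fst w) - X (snd w)\<bar>" for w
  define dY where "dY w = \<bar>Y (fst w) - Y (snd w)\<bar>" for w
  define H where "H w = dX w - a (fst w) - a (snd w) + \<alpha>" for w
  have [measurable]: "dX \<in> borel_measurable ?MM" "dY \<in> borel_measurable ?MM"
    unfolding dX_def[abs_def] dY_def[abs_def] by measurable
  have [measurable]: "H \<in> borel_measurable ?MM"
    unfolding H_def[abs_def] by measurable
  let ?L2 = "\<lambda>f :: 'a \<times> 'a \<Rightarrow> real. integrable ?MM (\<lambda>w. (f w)\<^sup>2)"
  have L2_diff: "?L2 (\<lambda>w. f w - g w)"
    if "?L2 f" "?L2 g" and [measurable]: "f \<in> borel_measurable ?MM" "g \<in> borel_measurable ?MM"
    for f g
    using that integrable_mult_square_integrable[of f ?MM g]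
    by (simp add: power2_diff mult.assoc)
  have L2_add: "?L2 (\<lambda>w. f w + g w)"
    if "?L2 f" "?L2 g" and [measurable]: "f \<in> borel_measurable ?MM" "g \<in> borel_measurable ?MM"
    for f g
    using that integrable_mult_square_integrable[of f ?MM g]
    by (simp add: power2_sum mult.assoc)
  note fstI = integrable_pair_fst[OF assms(1) assms(1)]
  note sndI = integrable_pair_snd[OF assms(1) assms(1)]
  have sqa: "integrable M (\<lambda>\<omega>. (a \<omega>)\<^sup>2)" and sqb: "integrable M (\<lambda>\<omega>. (b \<omega>)\<^sup>2)"
    unfolding a_def b_def using assms by (auto intro: integrable_mean_distance_power2)
  have inta: "integrable M a" using sqa by (rule M.square_integrable_imp_integrable[rotated]) simp
  note L2a = fstI[OF sqa] sndI[OF sqa] and L2b = fstI[OF sqb] sndI[OF sqb]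
  have L2dX: "?L2 dX" unfolding dX_def using L2_diff[OF fstI[OF sqX] sndI[OF sqX]] by simp
  have L2dY: "?L2 dY" unfolding dY_def using L2_diff[OF fstI[OF sqY] sndI[OF sqY]] by simp
  have L2H: "?L2 H" unfolding H_def
    by (intro L2_add L2_diff L2dX L2a) (auto intro: P.P.integrable_const)
  have int_dX: "integrable ?MM dX"
    using L2dX by (rule P.P.square_integrable_imp_integrable[rotated]) simp
  have int_dY: "integrable ?MM dY"
    using L2dY by (rule P.P.square_integrable_imp_integrable[rotated]) simp
  have int_H: "integrable ?MM H"
    using L2H by (rule P.P.square_integrable_imp_integrable[rotated]) simp
  have int_HdY: "integrable ?MM (\<lambda>w. H w * dY w)"
    by (rule integrable_mult_square_integrable) (use L2H L2dY in auto)
  have int_Hb1: "integrable ?MM (\<lambda>w. H w * b (fst w))"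
    by (rule integrable_mult_square_integrable) (use L2H L2b in auto)
  have int_Hb2: "integrable ?MM (\<lambda>w. H w * b (snd w))"
    by (rule integrable_mult_square_integrable) (use L2H L2b in auto)
  have int_dXdY: "integrable ?MM (\<lambda>w. dX w * dY w)"
    by (rule integrable_mult_square_integrable) (use L2dX L2dY in auto)
  have int_a1dY: "integrable ?MM (\<lambda>w. a (fst w) * dY w)"
    by (rule integrable_mult_square_integrable) (use L2a L2dY in auto)
  have int_a2dY: "integrable ?MM (\<lambda>w. a (snd w) * dY w)"
    by (rule integrable_mult_square_integrable) (use L2a L2dY in auto)

  have slice_dX: "(\<integral>\<omega>'. dX (\<omega>, \<omega>') \<partial>M) = a \<omega>" "integrable M (\<lambda>\<omega>'. dX (\<omega>, \<omega>'))" for \<omega>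
    using X by (simp_all add: dX_def a_def mean_distance_def)
  have centred1: "(\<integral>\<omega>'. H (\<omega>, \<omega>') \<partial>M) = 0" for \<omega>
    using slice_dX[of \<omega>] inta by (simp add: H_def M.prob_space \<alpha>_def)
  have H_sym: "H (\<omega>, \<omega>') = H (\<omega>', \<omega>)" for \<omega> \<omega>'
    by (simp add: H_def dX_def abs_minus_commute)
  have centred2: "(\<integral>\<omega>. H (\<omega>, \<omega>') \<partial>M) = 0" for \<omega>'
    using centred1[of \<omega>'] by (simp add: H_sym[of _ \<omega>'])
  \<comment> \<open>One-copy factors integrate to zero against the doubly centred distance.\<close>
  have "(\<integral>w. H w * b (fst w) \<partial>?MM) = 0"
    using P.integral_fst'[OF int_Hb1] centred1 by simp
  moreover have "(\<integral>w. H w * b (snd w) \<partial>?MM) = 0"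
    using P.integral_snd[of "\<lambda>x y. H (x, y) * b y"] int_Hb2 centred2
    by (simp add: case_prod_unfold)
  moreover have "(\<integral>w. H w \<partial>?MM) = 0"
    using P.integral_fst'[OF int_H] centred1 by simp
  ultimately have kill: "(\<integral>w. H w * (dY w - b (fst w) - b (snd w) + \<beta>) \<partial>?MM)
      = (\<integral>w. H w * dY w \<partial>?MM)"
    using int_HdY int_Hb1 int_Hb2 int_H
    by (simp add: distrib_left right_diff_distrib)

  have slice_dY: "(\<integral>\<omega>'. dY (\<omega>, \<omega>') \<partial>M) = b \<omega>" for \<omega>
    by (simp add: dY_def b_def mean_distance_def)
  have "(\<integral>w. a (fst w) * dY w \<partial>?MM) = (\<integral>\<omega>. a \<omega> * b \<omega> \<partial>M)"
    using P.integral_fst'[OF int_a1dY] slice_dY by simp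
  moreover have "(\<integral>w. a (snd w) * dY w \<partial>?MM) = (\<integral>\<omega>. a \<omega> * b \<omega> \<partial>M)"
  proof -
    have "dY (\<omega>, \<omega>') = dY (\<omega>', \<omega>)" for \<omega> \<omega>'
      by (simp add: dY_def abs_minus_commute)
    then have "(\<integral>\<omega>. dY (\<omega>, \<omega>') \<partial>M) = b \<omega>'" for \<omega>'
      using slice_dY[of \<omega>'] by simp
    then show ?thesis
      using P.integral_snd[of "\<lambda>x y. a y * dY (x, y)"] int_a2dY
      by (simp add: case_prod_unfold)
  qed
  moreover have "(\<integral>w. dY w \<partial>?MM) = \<beta>"
    using P.integral_fst'[OF int_dY] slice_dY by (simp add: \<beta>_def)
  ultimately have "(\<integral>w. H w * dY w \<partial>?MM) =
      (\<integral>w. dX w * dY w \<partial>?MM) + \<alpha> * \<beta> - 2 * (\<integral>\<omega>. a \<omega> * b \<omega> \<partial>M)"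
    using int_dXdY int_a1dY int_a2dY int_dY
    by (simp add: H_def distrib_right left_diff_distrib)
  moreover have "bergsma_cov M X Y =
      1 / 4 * (\<integral>w. H w * (dY w - b (fst w) - b (snd w) + \<beta>) \<partial>?MM)"
    unfolding bergsma_cov_def bergsma_kernel_eq_centred_distance[OF assms(1) X]
      bergsma_kernel_eq_centred_distance[OF assms(1) Y]
    by (simp add: H_def dX_def dY_def a_def b_def \<alpha>_def \<beta>_def flip: integral_mult_right_zero)
  ultimately show ?thesis
    using kill by (simp add: dX_def dY_def a_def b_def \<alpha>_def \<beta>_def)
qed

section \<open>Rotation invariance of independent standard normal variables\<close>

lemma prob_space_std_normal: "prob_space std_normal_distribution"
  by (rule prob_space_normal_density) simp

lemma nn_integral_pair_std_normal:
  fixes f :: "real \<times> real \<Rightarrow> ennreal"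
  assumes [measurable]: "f \<in> borel_measurable (borel \<Otimes>\<^sub>M borel)"
  shows "(\<integral>\<^sup>+x. \<integral>\<^sup>+y. f (x, y) \<partial>std_normal_distribution \<partial>std_normal_distribution) =
    (\<integral>\<^sup>+x. \<integral>\<^sup>+y. ennreal (exp (- (x\<^sup>2 + y\<^sup>2) / 2) / (2 * pi)) * f (x, y) \<partial>lborel \<partial>lborel)"
proof -
  interpret prob_space std_normal_distribution by (rule prob_space_std_normal)
  have "exp (- x\<^sup>2 / 2) * exp (- y\<^sup>2 / 2) / (2 * pi) = exp (- (x\<^sup>2 + y\<^sup>2) / 2) / (2 * pi)" for x y :: real
    by (simp flip: exp_add add: add_divide_distrib)
  then have dens: "std_normal_density x * std_normal_density y = exp (- (x\<^sup>2 + y\<^sup>2) / 2) / (2 * pi)" for x y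
    by (simp add: std_normal_density_def)
  show ?thesis
    unfolding dens[symmetric]
    by (simp add: nn_integral_density ennreal_mult mult.assoc nn_integral_cmult[symmetric])
qed

text \<open>
  A rotation with nonzero cosine \<open>a\<close> is a composition of one-dimensional affine substitutions:
  with \<open>p = a x + b y\<close> and \<open>q = a y - b x\<close> one first replaces \<open>q\<close> by \<open>y\<close> for fixed \<open>p\<close>
  (factor \<open>1 / \<bar>a\<bar>\<close>), then \<open>p\<close> by \<open>x\<close> for fixed \<open>y\<close> (factor \<open>\<bar>a\<bar>\<close>). The Jacobian
  factors cancel, and the density depends only on the norm, which the rotation preserves.
\<close>

lemma std_normal_rotation_nonzero_cos:
  fixes f :: "real \<times> real \<Rightarrow> ennreal"
  assumes [measurable]: "f \<in> borel_measurable (borel \<Otimes>\<^sub>M borel)"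
    and ab: "a\<^sup>2 + b\<^sup>2 = 1" and a: "a \<noteq> 0"
  shows "(\<integral>\<^sup>+x. \<integral>\<^sup>+y. f (a * x + b * y, a * y - b * x) \<partial>std_normal_distribution \<partial>std_normal_distribution)
    = (\<integral>\<^sup>+x. \<integral>\<^sup>+y. f (x, y) \<partial>std_normal_distribution \<partial>std_normal_distribution)"
proof -
  define g :: "real \<Rightarrow> real \<Rightarrow> ennreal"
    where "g p q = ennreal (exp (- (p\<^sup>2 + q\<^sup>2) / 2) / (2 * pi)) * f (p, q)" for p q
  have [measurable]: "case_prod g \<in> borel_measurable (borel \<Otimes>\<^sub>M borel)"
    unfolding g_def by measurable
  have gm1: "g p \<in> borel_measurable borel" for p unfolding g_def by measurable
  have inner: "(\<integral>\<^sup>+q. g p q \<partial>lborel) = \<bar>1 / a\<bar> * (\<integral>\<^sup>+y. g p (- (b * p / a) + 1 / a * y) \<partial>lborel)" for p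
    by (rule nn_integral_real_affine) (use a gm1 in auto)
  have outer: "(\<integral>\<^sup>+p. g p (- (b * p / a) + 1 / a * y) \<partial>lborel)
      = \<bar>a\<bar> * (\<integral>\<^sup>+x. g (a * x + b * y) (- (b * (a * x + b * y) / a) + 1 / a * y) \<partial>lborel)" for y
    by (subst (1 2) add.commute[of "a * _"], rule nn_integral_real_affine) (use a in auto)
  have coord: "- (b * (a * x + b * y) / a) + 1 / a * y = a * y - b * x" for x y
  proof -
    have "a * (- (b * (a * x + b * y) / a) + 1 / a * y) = (1 - b\<^sup>2) * y - a * b * x"
      using a by (simp add: field_simps power2_eq_square)
    also have "\<dots> = a * (a * y - b * x)"
      using ab by (simp add: algebra_simps power2_eq_square flip: ab)
    finally show ?thesis using a by simp
  qed
  have norm_eq: "(a * x + b * y)\<^sup>2 + (a * y - b * x)\<^sup>2 = x\<^sup>2 + y\<^sup>2" for x y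
  proof -
    have "(a * x + b * y)\<^sup>2 + (a * y - b * x)\<^sup>2 = (a\<^sup>2 + b\<^sup>2) * (x\<^sup>2 + y\<^sup>2)"
      by (simp add: power2_eq_square algebra_simps)
    then show ?thesis by (simp add: ab)
  qed
  have "(\<integral>\<^sup>+x. \<integral>\<^sup>+y. f (x, y) \<partial>std_normal_distribution \<partial>std_normal_distribution)
      = (\<integral>\<^sup>+p. \<integral>\<^sup>+q. g p q \<partial>lborel \<partial>lborel)"
    by (simp add: nn_integral_pair_std_normal g_def)
  also have "\<dots> = \<bar>1 / a\<bar> * (\<integral>\<^sup>+p. \<integral>\<^sup>+y. g p (- (b * p / a) + 1 / a * y) \<partial>lborel \<partial>lborel)"
    unfolding inner by (rule nn_integral_cmult) measurable
  also have "(\<integral>\<^sup>+p. \<integral>\<^sup>+y. g p (- (b * p / a) + 1 / a * y) \<partial>lborel \<partial>lborel)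
      = (\<integral>\<^sup>+y. \<integral>\<^sup>+p. g p (- (b * p / a) + 1 / a * y) \<partial>lborel \<partial>lborel)"
    by (rule lborel_pair.Fubini') measurable
  also have "\<dots> = \<bar>a\<bar> * (\<integral>\<^sup>+y. \<integral>\<^sup>+x. g (a * x + b * y) (a * y - b * x) \<partial>lborel \<partial>lborel)"
    unfolding outer coord by (rule nn_integral_cmult) measurable
  also have "(\<integral>\<^sup>+y. \<integral>\<^sup>+x. g (a * x + b * y) (a * y - b * x) \<partial>lborel \<partial>lborel)
     = (\<integral>\<^sup>+x. \<integral>\<^sup>+y. g (a * x + b * y) (a * y - b * x) \<partial>lborel \<partial>lborel)"
    by (rule lborel_pair.Fubini') measurable
  also have "\<bar>1 / a\<bar> * (\<bar>a\<bar> * \<dots>) = \<dots>"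
    using a by (simp flip: mult.assoc ennreal_mult add: abs_divide)
  also have "\<dots> = (\<integral>\<^sup>+x. \<integral>\<^sup>+y. f (a * x + b * y, a * y - b * x)
      \<partial>std_normal_distribution \<partial>std_normal_distribution)"
    using nn_integral_pair_std_normal[of "\<lambda>(x, y). f (a * x + b * y, a * y - b * x)"]
    by (simp add: g_def norm_eq)
  finally show ?thesis by simp
qed

text \<open>
  For a quarter turn the substitution above breaks down, but a quarter turn is the square of an
  eighth turn, whose cosine is nonzero.
\<close>

lemma std_normal_rotation:
  fixes f :: "real \<times> real \<Rightarrow> ennreal"
  assumes [measurable]: "f \<in> borel_measurable (borel \<Otimes>\<^sub>M borel)"
    and ab: "a\<^sup>2 + b\<^sup>2 = 1"
  shows "(\<integral>\<^sup>+x. \<integral>\<^sup>+y. f (a * x + b * y, a * y - b * x) \<partial>std_normal_distribution \<partial>std_normal_distribution)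
    = (\<integral>\<^sup>+x. \<integral>\<^sup>+y. f (x, y) \<partial>std_normal_distribution \<partial>std_normal_distribution)"
proof (cases "a = 0")
  case False
  then show ?thesis using assms std_normal_rotation_nonzero_cos by blast
next
  case True
  define c where "c = 1 / sqrt (2 :: real)"
  define d where "d = b * c"
  have b2: "b\<^sup>2 = 1" using ab True by simp
  have c: "c\<^sup>2 = 1 / 2" "c \<noteq> 0" by (auto simp: c_def power_divide)
  have d: "d\<^sup>2 = 1 / 2" by (simp add: d_def power_mult_distrib b2 c)
  have cd: "c\<^sup>2 + d\<^sup>2 = 1" using c d by simp
  have cc: "c * c = 1 / 2" "d * d = 1 / 2" "c * d = b / 2"
    using c d by (simp_all add: power2_eq_square d_def)
  have eq: "c * (c * x + d * y) + d * (c * y - d * x) = b * y"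
     "c * (c * y - d * x) - d * (c * x + d * y) = - (b * x)" for x y
  proof -
    have "c * (c * x + d * y) + d * (c * y - d * x) = (c * c - d * d) * x + 2 * (c * d) * y"
      by (simp add: algebra_simps)
    then show "c * (c * x + d * y) + d * (c * y - d * x) = b * y" by (simp add: cc)
    have "c * (c * y - d * x) - d * (c * x + d * y) = (c * c - d * d) * y - 2 * (c * d) * x"
      by (simp add: algebra_simps)
    then show "c * (c * y - d * x) - d * (c * x + d * y) = - (b * x)" by (simp add: cc)
  qed
  have "(\<integral>\<^sup>+x. \<integral>\<^sup>+y. f (x, y) \<partial>std_normal_distribution \<partial>std_normal_distribution) =
      (\<integral>\<^sup>+x. \<integral>\<^sup>+y. f (c * x + d * y, c * y - d * x) \<partial>std_normal_distribution \<partial>std_normal_distribution)"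
    using std_normal_rotation_nonzero_cos[of f c d] c cd by simp
  also have "\<dots> = (\<integral>\<^sup>+x. \<integral>\<^sup>+y. f (c * (c * x + d * y) + d * (c * y - d * x),
      c * (c * y - d * x) - d * (c * x + d * y)) \<partial>std_normal_distribution \<partial>std_normal_distribution)"
    using std_normal_rotation_nonzero_cos[of "\<lambda>(x, y). f (c * x + d * y, c * y - d * x)" c d] c cd by simp
  finally show ?thesis using True by (simp add: eq)
qed

text \<open>
  Rotating so that the first axis points in the direction \<open>(a, b)\<close> shows that a combination of
  independent standard normals is again centred normal, with standard deviation
  \<open>sqrt (a\<^sup>2 + b\<^sup>2)\<close>.
\<close>

lemma std_normal_linear_combination:
  fixes f :: "real \<Rightarrow> ennreal"
  assumes [measurable]: "f \<in> borel_measurable borel"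
  shows "(\<integral>\<^sup>+x. \<integral>\<^sup>+y. f (a * x + b * y) \<partial>std_normal_distribution \<partial>std_normal_distribution)
    = (\<integral>\<^sup>+x. f (sqrt (a\<^sup>2 + b\<^sup>2) * x) \<partial>std_normal_distribution)"
proof -
  interpret prob_space std_normal_distribution by (rule prob_space_std_normal)
  define r where "r = sqrt (a\<^sup>2 + b\<^sup>2)"
  show ?thesis
  proof (cases "r = 0")
    case True
    then have "a = 0" "b = 0"
      by (auto simp: r_def sum_power2_eq_zero_iff)
    then show ?thesis using emeasure_space_1 by simp
  next
    case False
    have "r\<^sup>2 = a\<^sup>2 + b\<^sup>2" by (simp add: r_def)
    then have "(a / r)\<^sup>2 + (b / r)\<^sup>2 = r\<^sup>2 / r\<^sup>2"
      by (simp only: power_divide add_divide_distrib)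
    then have "(a / r)\<^sup>2 + (b / r)\<^sup>2 = 1"
      using False by simp
    moreover have "r * (a / r * x + b / r * y) = a * x + b * y" for x y
      using False by (simp add: field_simps)
    ultimately show ?thesis
      using std_normal_rotation[of "\<lambda>(x, y). f (r * x)" "a / r" "b / r"] emeasure_space_1
      by (simp add: r_def)
  qed
qed

section \<open>The absolute product moment of correlated normal variables\<close>

text \<open>
  For fixed slope \<open>t\<close> the exponential is, up to a factor, the density of a centred normal law with
  variance \<open>1 / (1 + t\<^sup>2)\<close>, so the integral is a third absolute moment of that law.
\<close>

lemma std_normal_pair_radial_moment:
  "(\<integral>\<^sup>+x. ennreal (exp (- (x\<^sup>2 + (x * t)\<^sup>2) / 2) / (2 * pi) * \<bar>x\<bar> ^ 3) \<partial>lborel)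
    = ennreal (2 / pi / (1 + t\<^sup>2)\<^sup>2)"
proof -
  define \<sigma> where "\<sigma> = 1 / sqrt (1 + t\<^sup>2)"
  have pos: "1 + t\<^sup>2 > 0" by (smt (verit) zero_le_power2)
  have \<sigma>: "\<sigma> > 0" "\<sigma>\<^sup>2 = 1 / (1 + t\<^sup>2)"
    using pos by (simp_all add: \<sigma>_def power_divide)
  have dens: "exp (- (x\<^sup>2 + (x * t)\<^sup>2) / 2) / (2 * pi) = \<sigma> / sqrt (2 * pi) * normal_density 0 \<sigma> x" for x
  proof -
    have "(x\<^sup>2 + (x * t)\<^sup>2) / 2 = x\<^sup>2 / (2 * \<sigma>\<^sup>2)"
      unfolding \<sigma>(2) using pos by (simp add: field_simps power_mult_distrib)
    moreover have "sqrt (2 * pi * \<sigma>\<^sup>2) = sqrt (2 * pi) * \<sigma>"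
      using \<sigma>(1) by (simp add: real_sqrt_mult)
    moreover have "sqrt (2 * pi) * sqrt (2 * pi) = 2 * pi" by simp
    ultimately show ?thesis
      using \<sigma>(1) by (simp add: normal_density_def field_simps)
  qed
  have "has_bochner_integral lborel (\<lambda>x. normal_density 0 \<sigma> x * \<bar>x\<bar> ^ 3) (2 * \<sigma> ^ 3 * sqrt (2 / pi))"
    using normal_moment_abs_odd[OF \<sigma>(1), of 0 1] by (simp add: eval_nat_numeral)
  then have "has_bochner_integral lborel
      (\<lambda>x. \<sigma> / sqrt (2 * pi) * (normal_density 0 \<sigma> x * \<bar>x\<bar> ^ 3))
      (\<sigma> / sqrt (2 * pi) * (2 * \<sigma> ^ 3 * sqrt (2 / pi)))"
    by (rule has_bochner_integral_mult_right)
  moreover have "\<sigma> / sqrt (2 * pi) * (2 * \<sigma> ^ 3 * sqrt (2 / pi)) = 2 / pi / (1 + t\<^sup>2)\<^sup>2"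
  proof -
    have "sqrt (2 / pi) / sqrt (2 * pi) = 1 / pi"
      by (simp add: real_sqrt_mult real_sqrt_divide)
    then have "\<sigma> / sqrt (2 * pi) * (2 * \<sigma> ^ 3 * sqrt (2 / pi)) = 2 * (\<sigma>\<^sup>2)\<^sup>2 / pi"
      by (simp add: field_simps eval_nat_numeral)
    then show ?thesis by (simp add: \<sigma> power_divide)
  qed
  ultimately have "has_bochner_integral lborel
      (\<lambda>x. exp (- (x\<^sup>2 + (x * t)\<^sup>2) / 2) / (2 * pi) * \<bar>x\<bar> ^ 3) (2 / pi / (1 + t\<^sup>2)\<^sup>2)"
    unfolding dens by (simp add: mult.assoc)
  then show ?thesis
    by (subst nn_integral_eq_integral)
       (auto simp: has_bochner_integral_iff)
qed

text \<open>
  The function \<open>G\<close> of the proof is an explicit antiderivative, and the arcsine enters through its value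
  at the zero \<open>- r / sqrt (1 - r\<^sup>2)\<close> of the numerator. The second conclusion makes
  it possible to add two such values inside \<open>ennreal\<close>.
\<close>

lemma nn_integral_rational_halfline:
  assumes r: "-1 < r" "r < 1"
  shows "(\<integral>\<^sup>+t. ennreal ((r + sqrt (1 - r\<^sup>2) * t) / (1 + t\<^sup>2)\<^sup>2) * indicator {- r / sqrt (1 - r\<^sup>2)..} t \<partial>lborel)
    = ennreal (r * pi / 4 + (r * arcsin r + sqrt (1 - r\<^sup>2)) / 2)" (is ?integral)
    and "0 \<le> r * pi / 4 + (r * arcsin r + sqrt (1 - r\<^sup>2)) / 2" (is ?nonneg)
proof -
  define s where "s = sqrt (1 - r\<^sup>2)"
  have "r\<^sup>2 < 1" using r by (simp add: abs_square_less_1)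
  then have s: "s > 0" "s\<^sup>2 = 1 - r\<^sup>2" by (simp_all add: s_def)
  define G where "G t = r / 2 * (t / (1 + t\<^sup>2) + arctan t) - s / (2 * (1 + t\<^sup>2))" for t
  have pos: "1 + t\<^sup>2 \<noteq> 0" for t :: real by (smt (verit) zero_le_power2)
  have deriv: "DERIV G t :> (r + s * t) / (1 + t\<^sup>2)\<^sup>2" for t
  proof -
    have "((\<lambda>t. t / (1 + t\<^sup>2)) has_real_derivative (1 - t\<^sup>2) / (1 + t\<^sup>2)\<^sup>2) (at t)"
      by (rule derivative_eq_intros refl | simp add: pos)+ (simp add: power2_eq_square)
    moreover have "((\<lambda>t. 1 / (1 + t\<^sup>2)) has_real_derivative - (2 * t) / (1 + t\<^sup>2)\<^sup>2) (at t)"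
      by (rule derivative_eq_intros refl | simp add: pos)+ (simp add: power2_eq_square)
    moreover have "(arctan has_real_derivative (1 + t\<^sup>2) / (1 + t\<^sup>2)\<^sup>2) (at t)"
      using DERIV_arctan[of t] pos[of t] by (simp add: power2_eq_square[of "1 + t\<^sup>2"] inverse_eq_divide)
    ultimately have "((\<lambda>t. r / 2 * (t / (1 + t\<^sup>2) + arctan t) - s / 2 * (1 / (1 + t\<^sup>2)))
        has_real_derivative r / 2 * ((1 - t\<^sup>2) / (1 + t\<^sup>2)\<^sup>2 + (1 + t\<^sup>2) / (1 + t\<^sup>2)\<^sup>2)
          - s / 2 * (- (2 * t) / (1 + t\<^sup>2)\<^sup>2)) (at t)"
      by (intro DERIV_diff DERIV_cmult DERIV_add)
    also have "(\<lambda>t. r / 2 * (t / (1 + t\<^sup>2) + arctan t) - s / 2 * (1 / (1 + t\<^sup>2))) = G"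
      by (simp add: G_def[abs_def])
    also have "r / 2 * ((1 - t\<^sup>2) / (1 + t\<^sup>2)\<^sup>2 + (1 + t\<^sup>2) / (1 + t\<^sup>2)\<^sup>2)
          - s / 2 * (- (2 * t) / (1 + t\<^sup>2)\<^sup>2) = (r + s * t) / (1 + t\<^sup>2)\<^sup>2"
      by (simp add: add_divide_distrib[symmetric])
    finally show ?thesis .
  qed
  have lim: "(G \<longlongrightarrow> r * pi / 4) at_top"
  proof -
    have "((\<lambda>t::real. t / (1 + t\<^sup>2)) \<longlongrightarrow> 0) at_top" by real_asymp
    moreover have "((\<lambda>t::real. 1 / (1 + t\<^sup>2)) \<longlongrightarrow> 0) at_top" by real_asymp
    ultimately have "((\<lambda>t. r / 2 * (t / (1 + t\<^sup>2) + arctan t) - s / 2 * (1 / (1 + t\<^sup>2)))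
        \<longlongrightarrow> r / 2 * (0 + pi / 2) - s / 2 * 0) at_top"
      by (intro tendsto_intros tendsto_arctan_at_top)
    then show ?thesis by (simp add: G_def[abs_def])
  qed
  have at_start: "G (- r / s) = - (r * arcsin r + s) / 2"
  proof -
    have "1 + (- r / s)\<^sup>2 = 1 / s\<^sup>2"
      using s by (simp add: power_divide field_simps)
    moreover have "arctan (- r / s) = - arcsin r"
      using r by (simp add: arcsin_arctan s_def arctan_minus)
    ultimately have "G (- r / s) = r / 2 * (- r / s / (1 / s\<^sup>2) + - arcsin r) - s / (2 * (1 / s\<^sup>2))"
      by (simp only: G_def)
    also have "\<dots> = r / 2 * (- r * s - arcsin r) - s * s\<^sup>2 / 2"
      using s(1) by (simp add: power2_eq_square[of s])
    finally show ?thesis unfolding s(2) by (simp add: field_simps power2_eq_square)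
  qed
  have total: "r * pi / 4 - G (- r / s) = r * pi / 4 + (r * arcsin r + s) / 2"
    unfolding at_start by (simp add: field_simps)
  have integrand_nonneg: "0 \<le> (r + s * t) / (1 + t\<^sup>2)\<^sup>2" if "- r / s \<le> t" for t
  proof -
    have "0 \<le> r + s * t" using s that by (simp add: field_simps)
    then show ?thesis by simp
  qed
  have "(\<integral>\<^sup>+t. ennreal ((r + s * t) / (1 + t\<^sup>2)\<^sup>2) * indicator {- r / s..} t \<partial>lborel)
      = ennreal (r * pi / 4 - G (- r / s))"
    by (rule nn_integral_FTC_atLeast[OF _ deriv integrand_nonneg lim]) measurable
  then show ?integral unfolding total unfolding s_def .
  have "G (- r / s) \<le> G t" if "- r / s \<le> t" for t
    using that by (rule DERIV_nonneg_imp_nondecreasing) (use deriv integrand_nonneg in blast)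
  then have "G (- r / s) \<le> r * pi / 4"
    by (intro tendsto_lowerbound[OF lim]) (auto intro: eventually_at_top_linorderI)
  then show ?nonneg using total unfolding s_def by linarith
qed

text \<open>
  The two half-lines on which \<open>r + sqrt (1 - r\<^sup>2) * t\<close> has constant sign are exchanged by the
  reflection that replaces \<open>(r, t)\<close> by \<open>(- r, - t)\<close>, so both are covered by the previous
  lemma, and the two contributions \<open>r * pi / 4\<close> and \<open>- r * pi / 4\<close> cancel.
\<close>

lemma nn_integral_abs_affine_rational:
  assumes r: "-1 < r" "r < 1"
  shows "(\<integral>\<^sup>+t. ennreal (\<bar>r + sqrt (1 - r\<^sup>2) * t\<bar> / (1 + t\<^sup>2)\<^sup>2) \<partial>lborel)
    = ennreal (r * arcsin r + sqrt (1 - r\<^sup>2))"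
proof -
  define s where "s = sqrt (1 - r\<^sup>2)"
  have "r\<^sup>2 < 1" using r by (simp add: abs_square_less_1)
  then have s: "s > 0" by (simp add: s_def)
  let ?h = "\<lambda>r t. ennreal ((r + s * t) / (1 + t\<^sup>2)\<^sup>2) * indicator {- r / s..} t"
  have split: "AE t in lborel. ennreal (\<bar>r + s * t\<bar> / (1 + t\<^sup>2)\<^sup>2) = ?h r t + ?h (- r) (- t)"
  proof (rule AE_mp[OF AE_lborel_singleton[of "- r / s"]], rule AE_I2, rule impI)
    fix t assume "t \<noteq> - r / s"
    then consider "t > - r / s" | "t < - r / s" by linarith
    then show "ennreal (\<bar>r + s * t\<bar> / (1 + t\<^sup>2)\<^sup>2) = ?h r t + ?h (- r) (- t)"
    proof cases
      case 1
      then have "r + s * t > 0" using s by (simp add: field_simps)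
      then show ?thesis using 1 by (simp add: indicator_def)
    next
      case 2
      then have "r + s * t < 0" using s by (simp add: field_simps)
      then show ?thesis using 2 by (simp add: indicator_def)
    qed
  qed
  have "(\<integral>\<^sup>+t. ennreal (\<bar>r + s * t\<bar> / (1 + t\<^sup>2)\<^sup>2) \<partial>lborel)
      = (\<integral>\<^sup>+t. ?h r t + ?h (- r) (- t) \<partial>lborel)"
    by (rule nn_integral_cong_AE[OF split])
  also have "\<dots> = (\<integral>\<^sup>+t. ?h r t \<partial>lborel) + (\<integral>\<^sup>+t. ?h (- r) (- t) \<partial>lborel)"
    by (rule nn_integral_add) measurable
  also have "(\<integral>\<^sup>+t. ?h (- r) (- t) \<partial>lborel) = (\<integral>\<^sup>+t. ?h (- r) t \<partial>lborel)"
    using nn_integral_real_affine[of "?h (- r)" "-1" 0] by simp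
  also have "(\<integral>\<^sup>+t. ?h (- r) t \<partial>lborel) = ennreal (- r * pi / 4 + (r * arcsin r + s) / 2)"
    using nn_integral_rational_halfline(1)[of "- r"] r by (simp add: s_def arcsin_minus)
  also have "(\<integral>\<^sup>+t. ?h r t \<partial>lborel) = ennreal (r * pi / 4 + (r * arcsin r + s) / 2)"
    using nn_integral_rational_halfline(1)[OF r] by (simp add: s_def)
  also have "ennreal (r * pi / 4 + (r * arcsin r + s) / 2) + ennreal (- r * pi / 4 + (r * arcsin r + s) / 2)
      = ennreal (r * arcsin r + s)"
    using nn_integral_rational_halfline(2)[OF r] nn_integral_rational_halfline(2)[of "- r"] r
    by (simp add: s_def arcsin_minus flip: ennreal_plus)
  finally show ?thesis by (simp add: s_def)
qed

text \<open>
  This is \<open>E (\<bar>U\<bar> \<bar>V\<bar>)\<close> for standard normal \<open>U, V\<close> with correlation \<open>r\<close>, where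
  \<open>V = r U + sqrt (1 - r\<^sup>2) W\<close>. Passing from \<open>(x, y)\<close> to \<open>x\<close> and the slope
  \<open>t = y / x\<close> makes the integrand a product \<open>k x t * \<bar>r + sqrt (1 - r\<^sup>2) * t\<bar>\<close> whose
  second factor is free of \<open>x\<close>. Integrating over \<open>x\<close> first leaves a rational integral in \<open>t\<close>.
\<close>

lemma abs_product_moment_bivariate_normal:
  assumes r: "-1 < r" "r < 1"
  shows "(\<integral>\<^sup>+x. \<integral>\<^sup>+y. ennreal (\<bar>x\<bar> * \<bar>r * x + sqrt (1 - r\<^sup>2) * y\<bar>)
      \<partial>std_normal_distribution \<partial>std_normal_distribution)
    = ennreal (2 / pi * (r * arcsin r + sqrt (1 - r\<^sup>2)))"
proof -
  define s where "s = sqrt (1 - r\<^sup>2)"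
  define g where "g x y = exp (- (x\<^sup>2 + y\<^sup>2) / 2) / (2 * pi) * (\<bar>x\<bar> * \<bar>r * x + s * y\<bar>)" for x y :: real
  define k where "k x t = exp (- (x\<^sup>2 + (x * t)\<^sup>2) / 2) / (2 * pi) * \<bar>x\<bar> ^ 3" for x t :: real
  have [measurable]: "case_prod g \<in> borel_measurable (borel \<Otimes>\<^sub>M borel)"
    "case_prod k \<in> borel_measurable (borel \<Otimes>\<^sub>M borel)"
    unfolding g_def k_def by measurable
  have gm: "g x \<in> borel_measurable borel" for x unfolding g_def by measurable
  have slope: "(\<integral>\<^sup>+y. ennreal (g x y) \<partial>lborel) = (\<integral>\<^sup>+t. ennreal (k x t * \<bar>r + s * t\<bar>) \<partial>lborel)"
    if "x \<noteq> 0" for x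
  proof -
    have "(\<integral>\<^sup>+y. ennreal (g x y) \<partial>lborel) = \<bar>x\<bar> * (\<integral>\<^sup>+t. ennreal (g x (0 + x * t)) \<partial>lborel)"
      by (rule nn_integral_real_affine) (use that gm in auto)
    also have "\<dots> = (\<integral>\<^sup>+t. ennreal (\<bar>x\<bar> * g x (x * t)) \<partial>lborel)"
      using gm by (simp add: nn_integral_cmult[symmetric] ennreal_mult')
    also have "\<dots> = (\<integral>\<^sup>+t. ennreal (k x t * \<bar>r + s * t\<bar>) \<partial>lborel)"
    proof (rule nn_integral_cong)
      fix t
      have "r * x + s * (x * t) = x * (r + s * t)" by (simp add: algebra_simps)
      then show "ennreal (\<bar>x\<bar> * g x (x * t)) = ennreal (k x t * \<bar>r + s * t\<bar>)"
        by (simp add: g_def k_def abs_mult eval_nat_numeral)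
    qed
    finally show ?thesis .
  qed
  have "(\<integral>\<^sup>+x. \<integral>\<^sup>+y. ennreal (\<bar>x\<bar> * \<bar>r * x + s * y\<bar>) \<partial>std_normal_distribution \<partial>std_normal_distribution)
    = (\<integral>\<^sup>+x. \<integral>\<^sup>+y. ennreal (g x y) \<partial>lborel \<partial>lborel)"
  proof -
    have "ennreal (g x y) = ennreal (exp (- (x\<^sup>2 + y\<^sup>2) / 2) / (2 * pi)) * ennreal (\<bar>x\<bar> * \<bar>r * x + s * y\<bar>)"
      for x y unfolding g_def by (rule ennreal_mult) simp_all
    then show ?thesis
      using nn_integral_pair_std_normal[of "\<lambda>(x, y). ennreal (\<bar>x\<bar> * \<bar>r * x + s * y\<bar>)"]
      by simp
  qed
  also have "\<dots> = (\<integral>\<^sup>+x. \<integral>\<^sup>+t. ennreal (k x t * \<bar>r + s * t\<bar>) \<partial>lborel \<partial>lborel)"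
    by (rule nn_integral_cong_AE) (use AE_lborel_singleton[of 0] slope in \<open>auto elim!: eventually_mono\<close>)
  also have "\<dots> = (\<integral>\<^sup>+t. \<integral>\<^sup>+x. ennreal (k x t * \<bar>r + s * t\<bar>) \<partial>lborel \<partial>lborel)"
    by (rule lborel_pair.Fubini') measurable
  also have "\<dots> = (\<integral>\<^sup>+t. ennreal (2 / pi) * ennreal (\<bar>r + s * t\<bar> / (1 + t\<^sup>2)\<^sup>2) \<partial>lborel)"
  proof (rule nn_integral_cong)
    fix t :: real
    have "(\<integral>\<^sup>+x. ennreal (k x t * \<bar>r + s * t\<bar>) \<partial>lborel) = (\<integral>\<^sup>+x. ennreal (k x t) * ennreal \<bar>r + s * t\<bar> \<partial>lborel)"
      by (intro nn_integral_cong ennreal_mult) (simp_all add: k_def)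
    also have "\<dots> = (\<integral>\<^sup>+x. ennreal (k x t) \<partial>lborel) * ennreal \<bar>r + s * t\<bar>"
      by (rule nn_integral_multc) (simp add: k_def)
    also have "\<dots> = ennreal (2 / pi / (1 + t\<^sup>2)\<^sup>2) * ennreal \<bar>r + s * t\<bar>"
      unfolding k_def std_normal_pair_radial_moment ..
    also have "\<dots> = ennreal (2 / pi) * ennreal (\<bar>r + s * t\<bar> / (1 + t\<^sup>2)\<^sup>2)"
      by (simp flip: ennreal_mult)
    finally show "(\<integral>\<^sup>+x. ennreal (k x t * \<bar>r + s * t\<bar>) \<partial>lborel)
      = ennreal (2 / pi) * ennreal (\<bar>r + s * t\<bar> / (1 + t\<^sup>2)\<^sup>2)" .
  qed
  also have "\<dots> = ennreal (2 / pi) * ennreal (r * arcsin r + s)"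
    by (subst nn_integral_cmult) (simp_all add: nn_integral_abs_affine_rational[OF r] s_def)
  also have "\<dots> = ennreal (2 / pi * (r * arcsin r + s))"
    by (rule ennreal_mult'[symmetric]) simp
  finally show ?thesis unfolding s_def .
qed

section \<open>The bivariate normal law as an affine image\<close>

abbreviation std_normal_pair :: "(real \<times> real) measure" where
  "std_normal_pair \<equiv> std_normal_distribution \<Otimes>\<^sub>M std_normal_distribution"

text \<open>
  The map \<open>(u, w) \<mapsto> (m1 + s1 u, m2 + s2 (r u + sqrt (1 - r\<^sup>2) w))\<close> is triangular, so the change
  of variables is again two one-dimensional affine substitutions. Completing the square turns the
  quadratic form of the density into \<open>u\<^sup>2 + w\<^sup>2\<close>.
\<close>

lemma bivariate_normal_eq_distr:
  assumes s: "s1 > 0" "s2 > 0" and r: "-1 < r" "r < 1"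
  shows "density (lborel \<Otimes>\<^sub>M lborel) (\<lambda>p. ennreal (bivariate_normal_density m1 m2 s1 s2 r p))
    = distr std_normal_pair (borel \<Otimes>\<^sub>M borel)
        (\<lambda>w. (m1 + s1 * fst w, m2 + s2 * (r * fst w + sqrt (1 - r\<^sup>2) * snd w)))"
    (is "?L = distr _ _ ?T")
proof (rule measure_eqI)
  interpret N: prob_space std_normal_distribution by (rule prob_space_std_normal)
  show "sets ?L = sets (distr std_normal_pair (borel \<Otimes>\<^sub>M borel) ?T)"
    by (simp cong: sets_pair_measure_cong)
  fix A assume "A \<in> sets ?L"
  then have [measurable]: "A \<in> sets (borel \<Otimes>\<^sub>M borel)"
    by (simp cong: sets_pair_measure_cong)
  define q where "q = sqrt (1 - r\<^sup>2)"
  have "r\<^sup>2 < 1" using r by (simp add: abs_square_less_1)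
  then have q: "q > 0" "q\<^sup>2 = 1 - r\<^sup>2" by (simp_all add: q_def)
  define d where "d x y = ennreal (bivariate_normal_density m1 m2 s1 s2 r (x, y)) * indicator A (x, y)" for x y
  have [measurable]: "bivariate_normal_density m1 m2 s1 s2 r \<in> borel_measurable (borel \<Otimes>\<^sub>M borel)"
    unfolding bivariate_normal_density_def by measurable
  have [measurable]: "case_prod d \<in> borel_measurable (borel \<Otimes>\<^sub>M borel)"
    unfolding d_def by measurable
  have dm: "d x \<in> borel_measurable borel" for x unfolding d_def by measurable
  have standardised: "s1 * s2 * q * bivariate_normal_density m1 m2 s1 s2 r (m1 + s1 * u, m2 + s2 * (r * u + q * w))
      = exp (- (u\<^sup>2 + w\<^sup>2) / 2) / (2 * pi)" for u w
  proof -
    have "u\<^sup>2 - 2 * r * u * (r * u + q * w) + (r * u + q * w)\<^sup>2 = (1 - r\<^sup>2) * u\<^sup>2 + q\<^sup>2 * w\<^sup>2"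
      by (simp add: power2_eq_square algebra_simps)
    then have form: "u\<^sup>2 - 2 * r * u * (r * u + q * w) + (r * u + q * w)\<^sup>2 = q\<^sup>2 * (u\<^sup>2 + w\<^sup>2)"
      by (simp add: q(2) distrib_left)
    have "- (u\<^sup>2 - 2 * r * u * (r * u + q * w) + (r * u + q * w)\<^sup>2) / (2 * (1 - r\<^sup>2)) = - (u\<^sup>2 + w\<^sup>2) / 2"
      unfolding form q(2)[symmetric] using q(1) by (simp add: field_simps)
    then show ?thesis
      using s q(1) by (simp add: bivariate_normal_density_def q_def[symmetric])
  qed
  have "emeasure ?L A = (\<integral>\<^sup>+p. ennreal (bivariate_normal_density m1 m2 s1 s2 r p) * indicator A p \<partial>(lborel \<Otimes>\<^sub>M lborel))"
    by (rule emeasure_density) (simp_all cong: sets_pair_measure_cong measurable_cong_sets)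
  also have "\<dots> = (\<integral>\<^sup>+x. \<integral>\<^sup>+y. d x y \<partial>lborel \<partial>lborel)"
    by (subst lborel.nn_integral_fst[symmetric]) (simp_all add: d_def[abs_def] cong: sets_pair_measure_cong measurable_cong_sets)
  also have "\<dots> = s1 * (\<integral>\<^sup>+u. \<integral>\<^sup>+y. d (m1 + s1 * u) y \<partial>lborel \<partial>lborel)"
    using nn_integral_real_affine[of "\<lambda>x. \<integral>\<^sup>+y. d x y \<partial>lborel" s1 m1] s by simp
  also have "(\<lambda>u. \<integral>\<^sup>+y. d (m1 + s1 * u) y \<partial>lborel)
      = (\<lambda>u. ennreal (s2 * q) * (\<integral>\<^sup>+w. d (m1 + s1 * u) (m2 + s2 * (r * u + q * w)) \<partial>lborel))"
  proof
    fix u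
    have "m2 + s2 * (r * u + q * w) = (m2 + s2 * r * u) + (s2 * q) * w" for w
      by (simp add: algebra_simps)
    then show "(\<integral>\<^sup>+y. d (m1 + s1 * u) y \<partial>lborel)
      = ennreal (s2 * q) * (\<integral>\<^sup>+w. d (m1 + s1 * u) (m2 + s2 * (r * u + q * w)) \<partial>lborel)"
      using nn_integral_real_affine[of "d (m1 + s1 * u)" "s2 * q" "m2 + s2 * r * u"] dm s q(1)
      by (simp add: add.assoc)
  qed
  also have "ennreal s1 * (\<integral>\<^sup>+u. ennreal (s2 * q) * (\<integral>\<^sup>+w. d (m1 + s1 * u) (m2 + s2 * (r * u + q * w)) \<partial>lborel) \<partial>lborel)
      = (\<integral>\<^sup>+u. \<integral>\<^sup>+w. ennreal (s1 * s2 * q) * d (m1 + s1 * u) (m2 + s2 * (r * u + q * w)) \<partial>lborel \<partial>lborel)"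
    using s q(1) by (simp add: nn_integral_cmult ennreal_mult mult.assoc)
  also have "\<dots> = (\<integral>\<^sup>+u. \<integral>\<^sup>+w. ennreal (exp (- (u\<^sup>2 + w\<^sup>2) / 2) / (2 * pi)) * indicator A (?T (u, w)) \<partial>lborel \<partial>lborel)"
    using s q(1) unfolding standardised[symmetric]
    by (simp add: d_def ennreal_mult' mult.assoc q_def[symmetric])
  also have "\<dots> = (\<integral>\<^sup>+u. \<integral>\<^sup>+w. indicator A (?T (u, w)) \<partial>std_normal_distribution \<partial>std_normal_distribution)"
    by (rule nn_integral_pair_std_normal[symmetric]) measurable
  also have "\<dots> = (\<integral>\<^sup>+w. indicator A (?T w) \<partial>std_normal_pair)"
    by (rule N.nn_integral_fst) measurable
  also have "\<dots> = emeasure (distr std_normal_pair (borel \<Otimes>\<^sub>M borel) ?T) A"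
    by (simp add: nn_integral_distr flip: nn_integral_indicator)
  finally show "emeasure ?L A = emeasure (distr std_normal_pair (borel \<Otimes>\<^sub>M borel) ?T) A" .
qed

text \<open>
  Bergsma's covariance depends on the joint law only, because it can be computed with the coordinate
  projections under that law. This allows replacing the given probability space by a concrete one.
\<close>

lemma bergsma_cov_distr_cong:
  fixes M :: "'a measure" and N :: "'b measure"
  assumes "prob_space M" "prob_space N"
    and [measurable]: "X \<in> borel_measurable M" "Y \<in> borel_measurable M"
      "U \<in> borel_measurable N" "V \<in> borel_measurable N"
    and law: "distr M (borel \<Otimes>\<^sub>M borel) (\<lambda>\<omega>. (X \<omega>, Y \<omega>)) = distr N (borel \<Otimes>\<^sub>M borel) (\<lambda>\<omega>. (U \<omega>, V \<omega>))"
  shows "bergsma_cov M X Y = bergsma_cov N U V"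
proof -
  have canonical: "bergsma_cov M X Y = bergsma_cov (distr M (borel \<Otimes>\<^sub>M borel) (\<lambda>\<omega>. (X \<omega>, Y \<omega>))) fst snd"
    if "prob_space M" and [measurable]: "X \<in> borel_measurable M" "Y \<in> borel_measurable M"
    for M :: "'c measure" and X Y
  proof -
    interpret M: prob_space M by fact
    let ?P = "distr M (borel \<Otimes>\<^sub>M borel) (\<lambda>\<omega>. (X \<omega>, Y \<omega>))"
    interpret P: prob_space ?P by (rule M.prob_space_distr) simp
    have PP: "?P \<Otimes>\<^sub>M ?P = distr (M \<Otimes>\<^sub>M M) ((borel \<Otimes>\<^sub>M borel) \<Otimes>\<^sub>M (borel \<Otimes>\<^sub>M borel))
        (\<lambda>(\<omega>1, \<omega>2). ((X \<omega>1, Y \<omega>1), (X \<omega>2, Y \<omega>2)))"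
      by (rule pair_measure_distr) (auto intro: P.sigma_finite_measure_axioms)
    have mX: "distr ?P borel fst = distr M borel X" "distr ?P borel snd = distr M borel Y"
      by (simp_all add: distr_distr comp_def)
    have kernel_measurable: "case_prod (bergsma_kernel (cdf (distr M borel Z))) \<in> borel_measurable (borel \<Otimes>\<^sub>M borel)"
      if [measurable]: "Z \<in> borel_measurable M" for Z
    proof -
      interpret D: prob_space "distr M borel Z" by (rule M.prob_space_distr) simp
      interpret DD: pair_prob_space "distr M borel Z" "distr M borel Z" ..
      have "interval_measure (cdf (distr M borel Z)) = distr M borel Z"
        by (rule interval_measure_cdf) simp
      then show ?thesis
        unfolding bergsma_kernel_def by simp
    qed
    note [measurable] = kernel_measurable[OF that(2)] kernel_measurable[OF that(3)]
    show ?thesis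
      unfolding bergsma_cov_def mX PP
      by (subst integral_distr) (simp_all add: case_prod_unfold)
  qed
  show ?thesis
    using canonical[OF assms(1,3,4)] canonical[OF assms(2,5,6)] law by simp
qed

section \<open>Scaling, and distance moments of a normal pair\<close>

lemma bergsma_cov_affine:
  assumes "prob_space M"
    and [measurable]: "X \<in> borel_measurable M" "Y \<in> borel_measurable M"
    and "integrable M (\<lambda>\<omega>. (X \<omega>)\<^sup>2)" "integrable M (\<lambda>\<omega>. (Y \<omega>)\<^sup>2)"
    and s: "s1 > 0" "s2 > 0"
  shows "bergsma_cov M (\<lambda>\<omega>. m1 + s1 * X \<omega>) (\<lambda>\<omega>. m2 + s2 * Y \<omega>) = s1 * s2 * bergsma_cov M X Y"
proof -
  interpret prob_space M by fact
  have dist_affine: "\<bar>(m + s * x) - (m + s * y)\<bar> = s * \<bar>x - y\<bar>" if "s > 0" for m s x y :: real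
    using that by (simp add: abs_mult flip: right_diff_distrib)
  have md: "mean_distance M (\<lambda>\<omega>. m + s * Z \<omega>) (m + s * z) = s * mean_distance M Z z"
    if "s > 0" for m s z and Z :: "'a \<Rightarrow> real"
    unfolding mean_distance_def dist_affine[OF that] by simp
  have sq: "integrable M (\<lambda>\<omega>. (m + s * Z \<omega>)\<^sup>2)"
    if [measurable]: "Z \<in> borel_measurable M" and "integrable M (\<lambda>\<omega>. (Z \<omega>)\<^sup>2)" for m s and Z :: "'a \<Rightarrow> real"
    using that square_integrable_imp_integrable[OF that] by (simp add: power2_sum power_mult_distrib mult.assoc)
  have prods: "s1 * x * (s2 * y) = s1 * s2 * (x * y)" for x y by simp
  have meas: "(\<lambda>\<omega>. m1 + s1 * X \<omega>) \<in> borel_measurable M" "(\<lambda>\<omega>. m2 + s2 * Y \<omega>) \<in> borel_measurable M"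
    by measurable
  show ?thesis
    unfolding bergsma_cov_eq_distance_moments[OF assms(1-5)]
      bergsma_cov_eq_distance_moments[OF assms(1) meas sq[OF assms(2,4)] sq[OF assms(3,5)]]
      md[OF s(1)] md[OF s(2)] dist_affine[OF s(1)] dist_affine[OF s(2)] prods
    by (simp add: algebra_simps)
qed

lemma ennreal_mean_distance:
  assumes "prob_space M" "integrable M X"
  shows "ennreal (mean_distance M X z) = (\<integral>\<^sup>+\<omega>. ennreal \<bar>z - X \<omega>\<bar> \<partial>M)"
proof -
  interpret prob_space M by fact
  show ?thesis
    unfolding mean_distance_def using assms(2) by (intro nn_integral_eq_integral[symmetric]) auto
qed

text \<open>
  The difference is \<open>sqrt 2\<close> times a standard normal variable.
\<close>

lemma std_normal_mean_difference:
   "(\<integral>\<^sup>+x. \<integral>\<^sup>+y. ennreal \<bar>x - y\<bar> \<partial>std_normal_distribution \<partial>std_normal_distribution) = ennreal (2 / sqrt pi)"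
proof -
  have "(\<integral>\<^sup>+x. \<integral>\<^sup>+y. ennreal \<bar>x - y\<bar> \<partial>std_normal_distribution \<partial>std_normal_distribution)
      = (\<integral>\<^sup>+x. ennreal \<bar>sqrt 2 * x\<bar> \<partial>std_normal_distribution)"
    using std_normal_linear_combination[of "\<lambda>z. ennreal \<bar>z\<bar>" 1 "-1"] by simp
  also have "\<dots> = ennreal (\<integral>x. \<bar>sqrt 2 * x\<bar> \<partial>std_normal_distribution)"
    using integrable_std_normal_distribution_moment[of 1] by (intro nn_integral_eq_integral) auto
  also have "(\<integral>x. \<bar>sqrt 2 * x\<bar> \<partial>std_normal_distribution) = sqrt 2 * sqrt (2 / pi)"
    using std_normal_distribution_odd_moments_abs[of 0] by (simp add: abs_mult)
  also have "\<dots> = 2 / sqrt pi" by (simp add: real_sqrt_divide)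
  finally show ?thesis .
qed

text \<open>
  For independent copies of a standard normal pair with correlation \<open>r\<close>, the coordinate
  differences are \<open>sqrt 2\<close> times such a pair, hence the value is twice the absolute product
  moment at \<open>r\<close>.
\<close>

lemma independent_differences_moment:
  assumes r: "-1 < r" "r < 1"
  defines "q \<equiv> sqrt (1 - r\<^sup>2)"
  shows "(\<integral>\<^sup>+x. \<integral>\<^sup>+x'. \<integral>\<^sup>+y. \<integral>\<^sup>+y'.
      ennreal (\<bar>x - x'\<bar> * \<bar>(r * x + q * y) - (r * x' + q * y')\<bar>)
      \<partial>std_normal_distribution \<partial>std_normal_distribution \<partial>std_normal_distribution \<partial>std_normal_distribution)
    = ennreal (4 / pi * (r * arcsin r + sqrt (1 - r\<^sup>2)))" (is "?L = _")
proof -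
  let ?N = std_normal_distribution
  interpret N: prob_space ?N by (rule prob_space_std_normal)
  have "r\<^sup>2 < 1" using r by (simp add: abs_square_less_1)
  then have q: "q > 0" by (simp add: q_def)
  have q2: "sqrt (q\<^sup>2 + (- q)\<^sup>2) = sqrt 2 * q"
    using q by (simp add: real_sqrt_mult flip: mult_2)
  define C where "C d = (\<integral>\<^sup>+t. ennreal (\<bar>d\<bar> * \<bar>r * d + sqrt 2 * q * t\<bar>) \<partial>?N)" for d
  have [measurable]: "C \<in> borel_measurable borel"
    unfolding C_def by measurable
  have "(\<integral>\<^sup>+y. \<integral>\<^sup>+y'. ennreal (\<bar>x - x'\<bar> * \<bar>(r * x + q * y) - (r * x' + q * y')\<bar>) \<partial>?N \<partial>?N) = C (x - x')" for x x'
  proof -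
    have eq: "(r * x + q * y) - (r * x' + q * y') = r * (x - x') + (q * y + - q * y')" for y y'
      by (simp add: algebra_simps)
    show ?thesis
      unfolding eq C_def q2[symmetric]
      by (rule std_normal_linear_combination[of "\<lambda>z. ennreal (\<bar>x - x'\<bar> * \<bar>r * (x - x') + z\<bar>)"]) measurable
  qed
  then have "?L = (\<integral>\<^sup>+x. \<integral>\<^sup>+x'. C (x - x') \<partial>?N \<partial>?N)" by simp
  also have "\<dots> = (\<integral>\<^sup>+x. C (sqrt 2 * x) \<partial>?N)"
    using std_normal_linear_combination[of C 1 "-1"] by simp
  also have "\<dots> = (\<integral>\<^sup>+x. \<integral>\<^sup>+t. 2 * ennreal (\<bar>x\<bar> * \<bar>r * x + q * t\<bar>) \<partial>?N \<partial>?N)"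
  proof -
    have "\<bar>sqrt 2 * x\<bar> * \<bar>r * (sqrt 2 * x) + sqrt 2 * q * t\<bar> = 2 * (\<bar>x\<bar> * \<bar>r * x + q * t\<bar>)" for x t
    proof -
      have "r * (sqrt 2 * x) + sqrt 2 * q * t = sqrt 2 * (r * x + q * t)" by (simp add: algebra_simps)
      then show ?thesis by (simp add: abs_mult)
    qed
    then show ?thesis by (simp add: C_def ennreal_mult')
  qed
  also have "\<dots> = 2 * ennreal (2 / pi * (r * arcsin r + sqrt (1 - r\<^sup>2)))"
    using abs_product_moment_bivariate_normal[OF r] by (simp add: nn_integral_cmult q_def)
  also have "\<dots> = ennreal (2 * (2 / pi * (r * arcsin r + sqrt (1 - r\<^sup>2))))"
    by (subst ennreal_mult') simp_all
  finally show ?thesis by simp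
qed

text \<open>
  This is \<open>E \<bar>X\<^sub>1 - X\<^sub>2\<bar> \<bar>Y\<^sub>1 - Y\<^sub>3\<bar>\<close>: only the first copies are dependent, so the
  correlation of the two differences drops to \<open>r / 2\<close>. To exhibit this, the independent normal part
  of \<open>Y\<^sub>1 - Y\<^sub>3\<close> is collected into one term of variance \<open>2 - r\<^sup>2\<close>, and \<open>(X\<^sub>1, X\<^sub>2)\<close> is
  rotated by an eighth turn, which makes the difference \<open>X\<^sub>1 - X\<^sub>2\<close> a coordinate \<open>p\<close> and leaves
  a contribution of \<open>X\<^sub>1\<close> that is independent of \<open>p\<close>.
\<close>

lemma split_differences_moment:
  assumes r: "-1 < r" "r < 1"
  defines "q \<equiv> sqrt (1 - r\<^sup>2)"
  shows "(\<integral>\<^sup>+x. \<integral>\<^sup>+y.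
      (\<integral>\<^sup>+v. ennreal \<bar>x - v\<bar> \<partial>std_normal_distribution)
      * (\<integral>\<^sup>+v. ennreal \<bar>(r * x + q * y) - v\<bar> \<partial>std_normal_distribution)
      \<partial>std_normal_distribution \<partial>std_normal_distribution)
    = ennreal (4 / pi * (r / 2 * arcsin (r / 2) + sqrt (1 - (r / 2)\<^sup>2)))" (is "?L = _")
proof -
  let ?N = std_normal_distribution
  interpret N: prob_space ?N by (rule prob_space_std_normal)
  have "r\<^sup>2 < 1" using r by (simp add: abs_square_less_1)
  then have q: "q\<^sup>2 = 1 - r\<^sup>2" by (simp add: q_def)
  define \<tau> where "\<tau> = sqrt (q\<^sup>2 + 1)"
  have \<tau>: "\<tau>\<^sup>2 = 2 - r\<^sup>2" using \<open>r\<^sup>2 < 1\<close> by (simp add: \<tau>_def q)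
  define c where "c = 1 / sqrt (2 :: real)"
  have c: "c * c = 1 / 2" "c\<^sup>2 = 1 / 2" by (simp_all add: c_def power_divide)
  define q' where "q' = sqrt (1 - (r / 2)\<^sup>2)"
  define B where "B x = (\<integral>\<^sup>+t. ennreal \<bar>r * x + \<tau> * t\<bar> \<partial>?N)" for x
  have [measurable]: "B \<in> borel_measurable borel" unfolding B_def by measurable
  \<comment> \<open>The noise of the first copy and the third copy together form one normal term of variance \<open>\<tau>\<^sup>2\<close>.\<close>
  have B: "(\<integral>\<^sup>+y. \<integral>\<^sup>+v. ennreal \<bar>(r * x + q * y) - v\<bar> \<partial>?N \<partial>?N) = B x" for x
    using std_normal_linear_combination[of "\<lambda>z. ennreal \<bar>r * x + z\<bar>" q "-1"]
    by (simp add: B_def \<tau>_def add_diff_eq)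
  have "?L = (\<integral>\<^sup>+x. \<integral>\<^sup>+v. ennreal \<bar>x - v\<bar> * B x \<partial>?N \<partial>?N)"
    by (simp add: nn_integral_cmult nn_integral_multc B)
  also have "\<dots> = (\<integral>\<^sup>+p. \<integral>\<^sup>+u. ennreal (sqrt 2 * \<bar>p\<bar>) * B (c * (p + u)) \<partial>?N \<partial>?N)"
  proof -
    define F where "F = (\<lambda>(p, u). ennreal (sqrt 2 * \<bar>p\<bar>) * B (c * (p + u)))"
    have [measurable]: "F \<in> borel_measurable (borel \<Otimes>\<^sub>M borel)" unfolding F_def by measurable
    have "F (c * x + - c * v, c * v - - c * x) = ennreal \<bar>x - v\<bar> * B x" for x v
    proof -
      have "c * x + - c * v = c * (x - v)" by (simp add: algebra_simps)
      then have "sqrt 2 * \<bar>c * x + - c * v\<bar> = \<bar>x - v\<bar>" by (simp add: abs_mult c_def)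
      moreover have "c * ((c * x + - c * v) + (c * v - - c * x)) = 2 * (c * c) * x"
        by (simp add: algebra_simps)
      then have "c * ((c * x + - c * v) + (c * v - - c * x)) = x" unfolding c by simp
      ultimately show ?thesis by (simp only: F_def prod.case)
    qed
    moreover have "(\<integral>\<^sup>+x. \<integral>\<^sup>+v. F (c * x + - c * v, c * v - - c * x) \<partial>?N \<partial>?N) = (\<integral>\<^sup>+p. \<integral>\<^sup>+u. F (p, u) \<partial>?N \<partial>?N)"
      by (rule std_normal_rotation) (simp_all add: c)
    ultimately show ?thesis by (simp only: F_def prod.case)
  qed
  also have "\<dots> = (\<integral>\<^sup>+p. ennreal (sqrt 2 * \<bar>p\<bar>) * (\<integral>\<^sup>+u. B (c * (p + u)) \<partial>?N) \<partial>?N)"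
    by (simp add: nn_integral_cmult)
  also have "\<dots> = (\<integral>\<^sup>+p. ennreal (sqrt 2 * \<bar>p\<bar>) * (\<integral>\<^sup>+t. ennreal (sqrt 2 * \<bar>r / 2 * p + q' * t\<bar>) \<partial>?N) \<partial>?N)"
  proof -
    \<comment> \<open>After normalising by \<open>sqrt 2\<close>, the variance not explained by \<open>p\<close> is \<open>1 - (r / 2)\<^sup>2\<close>.\<close>
    have "(r * c)\<^sup>2 + \<tau>\<^sup>2 = 2 * (1 - (r / 2)\<^sup>2)"
      by (simp add: power_mult_distrib c \<tau> power_divide)
    then have sd: "sqrt ((r * c)\<^sup>2 + \<tau>\<^sup>2) = sqrt 2 * q'"
      by (simp only: real_sqrt_mult q'_def)
    have "(\<integral>\<^sup>+u. B (c * (p + u)) \<partial>?N) = (\<integral>\<^sup>+t. ennreal (sqrt 2 * \<bar>r / 2 * p + q' * t\<bar>) \<partial>?N)" for p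
    proof -
      have eq: "r * (c * (p + u)) + \<tau> * t = r * c * p + (r * c * u + \<tau> * t)" for u t
        by (simp add: algebra_simps)
      have "(\<integral>\<^sup>+u. B (c * (p + u)) \<partial>?N) = (\<integral>\<^sup>+t. ennreal \<bar>r * c * p + sqrt 2 * q' * t\<bar> \<partial>?N)"
        unfolding B_def eq sd[symmetric]
        by (rule std_normal_linear_combination[of "\<lambda>z. ennreal \<bar>r * c * p + z\<bar>"]) measurable
      moreover have "\<bar>r * c * p + sqrt 2 * q' * t\<bar> = sqrt 2 * \<bar>r / 2 * p + q' * t\<bar>" for t
      proof -
        have "r * c = sqrt 2 * (r / 2)" by (simp add: c_def field_simps)
        then have "r * c * p + sqrt 2 * q' * t = sqrt 2 * (r / 2 * p + q' * t)"
          by (simp only: distrib_left mult.assoc)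
        then show ?thesis by (simp only: abs_mult) simp
      qed
      ultimately show ?thesis by simp
    qed
    then show ?thesis by simp
  qed
  also have "\<dots> = (\<integral>\<^sup>+p. \<integral>\<^sup>+t. 2 * ennreal (\<bar>p\<bar> * \<bar>r / 2 * p + q' * t\<bar>) \<partial>?N \<partial>?N)"
  proof -
    have "ennreal (sqrt 2 * \<bar>p\<bar>) * ennreal (sqrt 2 * \<bar>r / 2 * p + q' * t\<bar>)
        = 2 * ennreal (\<bar>p\<bar> * \<bar>r / 2 * p + q' * t\<bar>)" for p t
    proof -
      have "ennreal (sqrt 2 * \<bar>p\<bar>) * ennreal (sqrt 2 * \<bar>r / 2 * p + q' * t\<bar>)
        = ennreal (2 * (\<bar>p\<bar> * \<bar>r / 2 * p + q' * t\<bar>))"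
        by (subst ennreal_mult[symmetric]) (simp_all add: mult_ac)
      also have "\<dots> = ennreal 2 * ennreal (\<bar>p\<bar> * \<bar>r / 2 * p + q' * t\<bar>)"
        by (rule ennreal_mult) simp_all
      finally show ?thesis by simp
    qed
    then show ?thesis by (simp add: nn_integral_cmult[symmetric])
  qed
  also have "\<dots> = 2 * ennreal (2 / pi * (r / 2 * arcsin (r / 2) + q'))"
    using abs_product_moment_bivariate_normal[of "r / 2"] r by (simp add: nn_integral_cmult q'_def)
  also have "\<dots> = ennreal (2 * (2 / pi * (r / 2 * arcsin (r / 2) + q')))"
    by (subst ennreal_mult') simp_all
  finally show ?thesis by (simp add: q'_def)
qed

section \<open>Closed form and convexity\<close>

lemma prob_space_std_normal_pair: "prob_space std_normal_pair"
proof -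
  interpret N: prob_space std_normal_distribution by (rule prob_space_std_normal)
  interpret P: pair_prob_space std_normal_distribution std_normal_distribution ..
  show ?thesis by (rule P.P.prob_space_axioms)
qed

lemma square_integrable_std_normal_pair:
  "integrable std_normal_pair (\<lambda>w. (a * fst w + b * snd w)\<^sup>2)"
proof -
  have "integrable std_normal_pair (\<lambda>w. (fst w)\<^sup>2)" "integrable std_normal_pair (\<lambda>w. (snd w)\<^sup>2)"
    using integrable_std_normal_distribution_moment[of 2] prob_space_std_normal
    by (auto intro: integrable_pair_fst integrable_pair_snd)
  moreover from this have "integrable std_normal_pair (\<lambda>w. fst w * snd w)"
    by (intro integrable_mult_square_integrable) simp_all
  moreover have "(a * u + b * v)\<^sup>2 = a\<^sup>2 * u\<^sup>2 + b\<^sup>2 * v\<^sup>2 + 2 * a * b * (u * v)" for u v :: real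
    by (simp add: power2_eq_square algebra_simps)
  ultimately show ?thesis by simp
qed

text \<open>
  The distances are nonnegative, so every expectation in the three-term form may be computed as an
  iterated nonnegative integral in any order. The summand 1 comes from the product of the two mean
  differences, \<open>(2 / sqrt pi)\<^sup>2 = 4 / pi\<close>.
\<close>

lemma bergsma_cov_standard_bivariate_normal:
  assumes r: "-1 < r" "r < 1"
  defines "q \<equiv> sqrt (1 - r\<^sup>2)"
  shows "bergsma_cov std_normal_pair fst (\<lambda>w. r * fst w + q * snd w) =
    (r * arcsin r + q - 2 * (r / 2 * arcsin (r / 2) + sqrt (1 - (r / 2)\<^sup>2)) + 1) / pi"
proof -
  let ?N = std_normal_distribution and ?P = std_normal_pair
  let ?V = "\<lambda>w. r * fst w + q * snd w"
  interpret N: prob_space ?N by (rule prob_space_std_normal)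
  interpret P: prob_space ?P by (rule prob_space_std_normal_pair)
  interpret PP: pair_prob_space ?P ?P ..
  interpret NN: pair_sigma_finite ?N ?N ..
  have "r\<^sup>2 < 1" using r by (simp add: abs_square_less_1)
  then have q2: "r\<^sup>2 + q\<^sup>2 = 1" "q > 0" by (simp_all add: q_def)
  have sq: "integrable ?P (\<lambda>w. (fst w)\<^sup>2)" "integrable ?P (\<lambda>w. (?V w)\<^sup>2)"
    using square_integrable_std_normal_pair[of 1 0] square_integrable_std_normal_pair[of r q] by simp_all
  have int: "integrable ?P fst" "integrable ?P ?V"
    using sq by (auto intro!: P.square_integrable_imp_integrable)
  define A where "A z = (\<integral>\<^sup>+v. ennreal \<bar>z - v\<bar> \<partial>?N)" for z
  have [measurable]: "A \<in> borel_measurable borel" unfolding A_def by measurable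
  note [measurable] = borel_measurable_mean_distance[OF prob_space_std_normal_pair]
  have A_fst: "ennreal (mean_distance ?P fst z) = A z" for z
    unfolding ennreal_mean_distance[OF prob_space_std_normal_pair int(1)] A_def
    by (subst N.nn_integral_fst[symmetric]) (simp_all add: N.emeasure_space_1[simplified])
  have A_snd: "ennreal (mean_distance ?P ?V z) = A z" for z
    unfolding ennreal_mean_distance[OF prob_space_std_normal_pair int(2)] A_def
    using std_normal_linear_combination[of "\<lambda>v. ennreal \<bar>z - v\<bar>" r q]
    by (subst N.nn_integral_fst[symmetric]) (simp_all add: q2)
  have md_nonneg: "0 \<le> mean_distance ?P fst z" "0 \<le> mean_distance ?P ?V z" for z
    using mean_distance_bounds(1)[OF prob_space_std_normal_pair] int by auto
  have J_nonneg: "0 \<le> x * arcsin x + sqrt (1 - x\<^sup>2)" if "-1 < x" "x < 1" for x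
  proof -
    have "0 \<le> x * arcsin x"
      using that arcsin_le_arcsin[of 0 x] arcsin_le_arcsin[of x 0]
      by (cases "0 \<le> x") (auto simp: mult_nonneg_nonneg mult_nonpos_nonpos)
    moreover have "x\<^sup>2 \<le> 1" using that by (simp add: abs_square_le_1)
    ultimately show ?thesis by simp
  qed

  have "(\<integral>w. mean_distance ?P fst (fst w) \<partial>?P) = enn2real (\<integral>\<^sup>+w. A (fst w) \<partial>?P)"
    by (subst integral_eq_nn_integral) (auto simp: md_nonneg A_fst)
  also have "(\<integral>\<^sup>+w. A (fst w) \<partial>?P) = (\<integral>\<^sup>+x. A x \<partial>?N)"
    by (subst N.nn_integral_fst[symmetric]) (simp_all add: N.emeasure_space_1[simplified])
  also have A_mean: "\<dots> = ennreal (2 / sqrt pi)"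
    unfolding A_def by (rule std_normal_mean_difference)
  finally have \<alpha>: "(\<integral>w. mean_distance ?P fst (fst w) \<partial>?P) = 2 / sqrt pi" by simp

  have "(\<integral>w. mean_distance ?P ?V (?V w) \<partial>?P) = enn2real (\<integral>\<^sup>+w. A (?V w) \<partial>?P)"
    by (subst integral_eq_nn_integral) (auto simp: md_nonneg A_snd)
  also have "(\<integral>\<^sup>+w. A (?V w) \<partial>?P) = (\<integral>\<^sup>+x. A x \<partial>?N)"
    using std_normal_linear_combination[of A r q]
    by (subst N.nn_integral_fst[symmetric]) (simp_all add: q2)
  also note A_mean
  finally have \<beta>: "(\<integral>w. mean_distance ?P ?V (?V w) \<partial>?P) = 2 / sqrt pi" by simp

  have "(\<integral>w. mean_distance ?P fst (fst w) * mean_distance ?P ?V (?V w) \<partial>?P)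
      = enn2real (\<integral>\<^sup>+w. A (fst w) * A (?V w) \<partial>?P)"
    by (subst integral_eq_nn_integral) (auto simp: md_nonneg A_fst A_snd ennreal_mult)
  also have "(\<integral>\<^sup>+w. A (fst w) * A (?V w) \<partial>?P) = (\<integral>\<^sup>+x. \<integral>\<^sup>+y. A x * A (r * x + q * y) \<partial>?N \<partial>?N)"
    by (subst N.nn_integral_fst[symmetric]) simp_all
  also have "\<dots> = ennreal (4 / pi * (r / 2 * arcsin (r / 2) + sqrt (1 - (r / 2)\<^sup>2)))"
    unfolding A_def q_def by (rule split_differences_moment[OF r])
  finally have K: "(\<integral>w. mean_distance ?P fst (fst w) * mean_distance ?P ?V (?V w) \<partial>?P)
      = 4 / pi * (r / 2 * arcsin (r / 2) + sqrt (1 - (r / 2)\<^sup>2))"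
    using J_nonneg[of "r / 2"] r by simp

  \<comment> \<open>The quadruple integral is reordered so that the two copies of each noise variable are adjacent.\<close>
  let ?d = "\<lambda>x x' y y'. ennreal (\<bar>x - x'\<bar> * \<bar>(r * x + q * y) - (r * x' + q * y')\<bar>)"
  have "(\<integral>w. \<bar>fst (fst w) - fst (snd w)\<bar> * \<bar>?V (fst w) - ?V (snd w)\<bar> \<partial>(?P \<Otimes>\<^sub>M ?P))
      = enn2real (\<integral>\<^sup>+w. ?d (fst (fst w)) (fst (snd w)) (snd (fst w)) (snd (snd w)) \<partial>(?P \<Otimes>\<^sub>M ?P))"
    by (subst integral_eq_nn_integral) auto
  also have "(\<integral>\<^sup>+w. ?d (fst (fst w)) (fst (snd w)) (snd (fst w)) (snd (snd w)) \<partial>(?P \<Otimes>\<^sub>M ?P))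
      = (\<integral>\<^sup>+x. \<integral>\<^sup>+y. \<integral>\<^sup>+x'. \<integral>\<^sup>+y'. ?d x x' y y' \<partial>?N \<partial>?N \<partial>?N \<partial>?N)"
    by (subst P.nn_integral_fst[symmetric], simp, (subst N.nn_integral_fst[symmetric], simp)+) simp
  also have "\<dots> = (\<integral>\<^sup>+x. \<integral>\<^sup>+x'. \<integral>\<^sup>+y. \<integral>\<^sup>+y'. ?d x x' y y' \<partial>?N \<partial>?N \<partial>?N \<partial>?N)"
    by (intro nn_integral_cong NN.Fubini') measurable
  also have "\<dots> = ennreal (4 / pi * (r * arcsin r + sqrt (1 - r\<^sup>2)))"
    unfolding q_def by (rule independent_differences_moment[OF r])
  finally have D: "(\<integral>w. \<bar>fst (fst w) - fst (snd w)\<bar> * \<bar>?V (fst w) - ?V (snd w)\<bar> \<partial>(?P \<Otimes>\<^sub>M ?P))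
      = 4 / pi * (r * arcsin r + sqrt (1 - r\<^sup>2))"
    using J_nonneg[OF r] by simp

  have "bergsma_cov ?P fst ?V = 1 / 4 * (4 / pi * (r * arcsin r + sqrt (1 - r\<^sup>2))
      + 2 / sqrt pi * (2 / sqrt pi) - 2 * (4 / pi * (r / 2 * arcsin (r / 2) + sqrt (1 - (r / 2)\<^sup>2))))"
    using bergsma_cov_eq_distance_moments[OF prob_space_std_normal_pair _ _ sq]
    unfolding \<alpha> \<beta> K D by simp
  also have "2 / sqrt pi * (2 / sqrt pi) = 4 / pi" by simp
  finally show ?thesis
    by (simp add: q_def add_divide_distrib diff_divide_distrib)
qed

lemma bergsma_cov_bivariate_normal:
  assumes "prob_space M" and s: "s1 > 0" "s2 > 0" and r: "-1 < r" "r < 1"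
    and law: "distributed M (lborel \<Otimes>\<^sub>M lborel) (\<lambda>\<omega>. (X \<omega>, Y \<omega>))
      (\<lambda>p. ennreal (bivariate_normal_density m1 m2 s1 s2 r p))"
  shows "bergsma_cov M X Y = s1 * s2 / pi *
    (r * arcsin r + sqrt (1 - r\<^sup>2) - 2 * (r / 2 * arcsin (r / 2) + sqrt (1 - (r / 2)\<^sup>2)) + 1)"
proof -
  let ?P = std_normal_pair
  define q where "q = sqrt (1 - r\<^sup>2)"
  have XY: "(\<lambda>\<omega>. (X \<omega>, Y \<omega>)) \<in> M \<rightarrow>\<^sub>M borel \<Otimes>\<^sub>M borel"
    using distributed_measurable[OF law] by (simp cong: sets_pair_measure_cong measurable_cong_sets)
  have X: "X \<in> borel_measurable M" and Y: "Y \<in> borel_measurable M"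
    using measurable_compose[OF XY measurable_fst] measurable_compose[OF XY measurable_snd] by simp_all
  have "distr M (borel \<Otimes>\<^sub>M borel) (\<lambda>\<omega>. (X \<omega>, Y \<omega>)) = distr M (lborel \<Otimes>\<^sub>M lborel) (\<lambda>\<omega>. (X \<omega>, Y \<omega>))"
    by (rule distr_cong) (simp_all cong: sets_pair_measure_cong)
  also have "\<dots> = distr ?P (borel \<Otimes>\<^sub>M borel) (\<lambda>w. (m1 + s1 * fst w, m2 + s2 * (r * fst w + q * snd w)))"
    unfolding distributed_distr_eq_density[OF law] q_def by (rule bivariate_normal_eq_distr[OF s r])
  finally have "bergsma_cov M X Y =
      bergsma_cov ?P (\<lambda>w. m1 + s1 * fst w) (\<lambda>w. m2 + s2 * (r * fst w + q * snd w))"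
    using assms(1) X Y by (intro bergsma_cov_distr_cong prob_space_std_normal_pair) simp_all
  also have "\<dots> = s1 * s2 * bergsma_cov ?P fst (\<lambda>w. r * fst w + q * snd w)"
    using square_integrable_std_normal_pair[of 1 0] square_integrable_std_normal_pair[of r q]
    by (intro bergsma_cov_affine prob_space_std_normal_pair s) simp_all
  finally show ?thesis
    using bergsma_cov_standard_bivariate_normal[OF r] by (simp add: q_def)
qed

lemma DERIV_mult_arcsin_add_sqrt:
  assumes "-1 < x" "x < 1"
  shows "((\<lambda>x. x * arcsin x + sqrt (1 - x\<^sup>2)) has_real_derivative arcsin x) (at x)"
proof -
  have "x\<^sup>2 < 1" using assms by (simp add: abs_square_less_1)
  then show ?thesis
    using assms by (auto intro!: derivative_eq_intros simp: field_simps)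
qed

text \<open>
  The derivative of \<open>J x = x * arcsin x + sqrt (1 - x\<^sup>2)\<close> is \<open>arcsin x\<close>, so the second
  derivative of the function here is \<open>1 / sqrt (1 - r\<^sup>2) - 1 / (2 * sqrt (1 - r\<^sup>2 / 4))\<close>.
  The second fraction is at most half of the first.
\<close>

lemma convex_bivariate_normal_bergsma_cov:
  "convex_on {-1<..<1}
     (\<lambda>r. r * arcsin r + sqrt (1 - r\<^sup>2) - 2 * (r / 2 * arcsin (r / 2) + sqrt (1 - (r / 2)\<^sup>2)) + 1)"
proof (rule f''_ge0_imp_convex)
  show "convex {-1<..<1 :: real}" by simp
  fix r :: real assume r: "r \<in> {-1<..<1}"
  let ?J = "\<lambda>x :: real. x * arcsin x + sqrt (1 - x\<^sup>2)"
  have "((\<lambda>r. ?J (r / 2)) has_real_derivative arcsin (r / 2) * (1 / 2)) (at r)"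
    by (rule DERIV_chain2[where f = ?J, OF DERIV_mult_arcsin_add_sqrt])
       (use r in \<open>auto intro!: derivative_eq_intros\<close>)
  then have "((\<lambda>r. ?J r - 2 * ?J (r / 2) + 1) has_real_derivative
      arcsin r - 2 * (arcsin (r / 2) * (1 / 2)) + 0) (at r)"
    using r by (intro DERIV_add DERIV_diff DERIV_cmult DERIV_mult_arcsin_add_sqrt DERIV_const) auto
  then show "((\<lambda>r. ?J r - 2 * ?J (r / 2) + 1) has_real_derivative arcsin r - arcsin (r / 2)) (at r)"
    by simp
  have "((\<lambda>r. arcsin (r / 2)) has_real_derivative inverse (sqrt (1 - (r / 2)\<^sup>2)) * (1 / 2)) (at r)"
    by (rule DERIV_chain2[where f = arcsin, OF DERIV_arcsin])
       (use r in \<open>auto intro!: derivative_eq_intros\<close>)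
  then show "((\<lambda>r. arcsin r - arcsin (r / 2)) has_real_derivative
      inverse (sqrt (1 - r\<^sup>2)) - inverse (sqrt (1 - (r / 2)\<^sup>2)) * (1 / 2)) (at r)"
    using r by (intro DERIV_diff DERIV_arcsin) auto
  have "r\<^sup>2 < 1" using r by (auto simp: abs_square_less_1)
  then have "inverse (sqrt (1 - (r / 2)\<^sup>2)) \<le> inverse (sqrt (1 - r\<^sup>2))"
    by (intro le_imp_inverse_le) (simp_all add: power_divide)
  moreover have "0 \<le> inverse (sqrt (1 - (r / 2)\<^sup>2))"
    using \<open>r\<^sup>2 < 1\<close> by (simp add: power_divide)
  ultimately show "0 \<le> inverse (sqrt (1 - r\<^sup>2)) - inverse (sqrt (1 - (r / 2)\<^sup>2)) * (1 / 2)"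
    by linarith
qed

theorem lemma4:
  fixes m1 m2 \<sigma>1 \<sigma>2 :: real
    and M :: "real \<Rightarrow> 'a measure"
    and X Y :: "real \<Rightarrow> 'a \<Rightarrow> real"
  assumes "\<sigma>1 > 0" and "\<sigma>2 > 0"
    and "\<And>\<theta>. \<theta> \<in> {-1<..<1} \<Longrightarrow> prob_space (M \<theta>)"
    and "\<And>\<theta>. \<theta> \<in> {-1<..<1} \<Longrightarrow>
           distributed (M \<theta>) (lborel \<Otimes>\<^sub>M lborel) (\<lambda>\<omega>. (X \<theta> \<omega>, Y \<theta> \<omega>))
             (\<lambda>p. ennreal (bivariate_normal_density m1 m2 \<sigma>1 \<sigma>2 \<theta> p))"
  shows "convex_on {-1<..<1} (\<lambda>\<theta>. bergsma_cov (M \<theta>) (X \<theta>) (Y \<theta>))"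
proof -
  define \<kappa> where "\<kappa> r = \<sigma>1 * \<sigma>2 / pi *
    (r * arcsin r + sqrt (1 - r\<^sup>2) - 2 * (r / 2 * arcsin (r / 2) + sqrt (1 - (r / 2)\<^sup>2)) + 1)" for r
  have "convex_on {-1<..<1} \<kappa>"
    unfolding \<kappa>_def[abs_def] using assms(1,2)
    by (intro convex_on_cmul convex_bivariate_normal_bergsma_cov) simp
  moreover have "bergsma_cov (M \<theta>) (X \<theta>) (Y \<theta>) = \<kappa> \<theta>" if "\<theta> \<in> {-1<..<1}" for \<theta>
    unfolding \<kappa>_def using that assms by (intro bergsma_cov_bivariate_normal) auto
  ultimately show ?thesis
    unfolding convex_on_def convex_def by (simp add: Ball_def)
qed

end
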